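(* Let $F_1,F_2,F_3\colon X\to Y^\bullet$ be proper $K$-convex mappings and assume that $(C_0)$ there is $\widehat x\in\operatorname{dom}F_1$ such that $F_2$ is continuous at $\widehat x$. Then: (i) $\operatorname{epi}(F_1+F_2)^*=\Psi(\mathfrak{E}\mathrm{pi}F_1^*\boxplus\mathfrak{E}\mathrm{pi}F_2^* )$. (ii) $\Psi\big(\mathfrak{E}\mathrm{pi}(F_1+F_2)^*\boxplus\mathfrak{E}\mathrm{pi}F_3^*\big)=\Psi\big(\mathfrak{E}\mathrm{pi}F_1^*\boxplus\mathfrak{E}\mathrm{pi}F_2^*\boxplus\mathfrak{E}\mathrm{pi}F_3^*\big)$. (iii) If, in addition, one of the following conditions holds: $(C_0')$ there is $\tilde x\in\operatorname{dom}F_1\cap\operatorname{dom}F_2$ such that $F_3$ is continuous at $\tilde x$; $(C_0'')$ there is $\bar x\in\operatorname{dom}F_3$ such that $F_1$ and $F_2$ are continuous at $\bar x$; then $$\operatorname{epi}(F_1+F_2+F_3)^*=\Psi\big(\mathfrak{E}\mathrm{pi}(F_1+F_2)^*\boxplus\mathfrak{E}\mathrm{pi}F_3^*\big)=\Psi\big(\mathfrak{E}\mathrm{pi}F_1^*\boxplus\mathfrak{E}\mathrm{pi}F_2^*\boxplus\mathfrak{E}\mathrm{pi}F_3^*\big).$$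
   Context: **Spaces and order.** $X,Y$ are locally convex Hausdorff topological vector spaces; $K\subset Y$ is a proper ($K\ne Y$) closed convex cone with $\operatorname{int}K\neq\emptyset$. In $Y$: $y_1<_K y_2$ iff $y_1-y_2\in-\operatorname{int}K$, and $y_1\leqq_K y_2$ iff $y_1-y_2\in-K$. $Y^\bullet:=Y\cup\{-\infty_Y,+\infty_Y\}$ with $-\infty_Y<_K y<_K+\infty_Y$ for all $y\in Y$ (and $-\infty_Y<_K+\infty_Y$). Conventions: $-(\pm\infty_Y)=\mp\infty_Y$; $(+\infty_Y)+y=+\infty_Y$ for $y\in Y\cup\{+\infty_Y\}$; $(-\infty_Y)+y=-\infty_Y$ for $y\in Y\cup\{-\infty_Y\}$; sums of sets are elementwise. **Weak supremum.** For $M\subset Y^\bullet$, $\operatorname{WSup}M$ is the set of $\bar v\in Y^\bullet$ such that $\bar v\not<_K v$ for all $v\in M$ and, for every $\tilde v\in Y^\bullet$ with $\tilde v<_K\bar v$, there is $v\in M$ with $\tilde v<_K v$. **Set order and WS-sum.** For nonempty $M,N\subset Y^\bullet$, $M\preccurlyeq_K N$ means $v\not<_K u$ for all $u\in M$, $v\in N$. $\mathcal{P}_p(Y)$ is the collection of all $U\subset Y$ such that $Y=(U-\operatorname{int}K)\cup U\cup(U+\operatorname{int}K)$ with the three sets pairwise disjoint. For $U,V\in\mathcal{P}_p(Y)\cup\{\{+\infty_Y\}\}$, $U\uplus V:=\operatorname{WSup}(U+V)$, which again lies in $\mathcal{P}_p(Y)\cup\{\{+\infty_Y\}\}$. **Mappings.**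 For $H\colon X\to Y^\bullet$, $\operatorname{dom}H=\{x: H(x)\neq+\infty_Y\}$; $H$ is proper if $\operatorname{dom}H\ne\emptyset$ and $-\infty_Y\notin H(X)$; $H$ is $K$-convex if $\{(x,y)\in X\times Y: H(x)\leqq_K y\}$ is convex. $H$ is continuous at $x$ if $H(x)\in Y$ and every neighbourhood of $H(x)$ in $Y$ contains the image under $H$ of some neighbourhood of $x$. $\mathcal{L}(X,Y)$ is the space of continuous linear mappings $X\to Y$. **Conjugates and epigraphs.** For $H\colon X\to Y\cup\{+\infty_Y\}$: $H^*(L):=\operatorname{WSup}\{L(x)-H(x): x\in X\}$ for $L\in\mathcal{L}(X,Y)$; $\operatorname{dom}H^*:=\{L: H^*(L)\ne\{+\infty_Y\}\}$; $\operatorname{epi}H^*:=\{(L,y)\in\mathcal{L}(X,Y)\times Y: y\in H^*(L)+K\}$. The extended epigraph is $\mathfrak{E}\mathrm{pi}\,H^*:=\{(L,U)\in\mathcal{L}(X,Y)\times\mathcal{P}_p(Y): L\in\operatorname{dom}H^*,\ H^*(L)\preccurlyeq_K U\}$. For $\mathscr{M}_1,\mathscr{M}_2\subset\mathcal{L}(X,Y)\times\mathcal{P}_p(Y)$, $\mathscr{M}_1\boxplus\mathscr{M}_2:=\{(L_1+L_2,U_1\uplus U_2):(L_i,U_i)\in\mathscr{M}_i,\ U_1\uplus U_2\in\mathcal{P}_p(Y)\}$ (pairs with $U_1\uplus U_2=\{+\infty_Y\}$ are discarded); this operation is commutative and associative. For $\mathscr{M}\subset\mathcal{L}(X,Y)\times\mathcal{P}_p(Y)$,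 $\Psi(\mathscr{M}):=\bigcup_{(L,U)\in\mathscr{M}}\{L\}\times U\subset\mathcal{L}(X,Y)\times Y$. *)

theory Defs
  imports "HOL-Analysis.Analysis" "HOL-Library.Extended" "HOL-Library.Set_Algebras"
begin

text \<open>
  Locally convex Hausdorff real topological vector spaces. In \<open>locally_convex\<close> the convexity of
  \<open>V\<close> is unfolded, since \<^const>\<open>convex\<close> cannot be used in a class specification.
\<close>

class lctvs = real_vector + topological_ab_group_add + t2_space +
  assumes tendsto_scaleR_nhds:
    "LIM p (nhds (c::real) \<times>\<^sub>F nhds x). fst p *\<^sub>R snd p :> nhds (c *\<^sub>R x)"
  and locally_convex:
    "open U \<Longrightarrow> 0 \<in> U \<Longrightarrow> \<exists>V. open V \<and> 0 \<in> V \<and> V \<subseteq> U \<and>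
       (\<forall>x\<in>V. \<forall>y\<in>V. \<forall>s\<ge>0. \<forall>t\<ge>0. s + t = 1 \<longrightarrow> s *\<^sub>R x + t *\<^sub>R y \<in> V)"

instance real_normed_vector \<subseteq> lctvs
proof
  fix c :: real and x :: "'a"
  have "((\<lambda>p. fst p *\<^sub>R snd p) \<longlongrightarrow> c *\<^sub>R x) (nhds c \<times>\<^sub>F nhds x)"
    by (intro tendsto_scaleR filterlim_fst filterlim_snd)
  then show "LIM p (nhds c \<times>\<^sub>F nhds x). fst p *\<^sub>R snd p :> nhds (c *\<^sub>R x)" .
next
  fix U :: "'a set"
  assume "open U" "0 \<in> U"
  then obtain e where "e > 0" "ball 0 e \<subseteq> U"
    by (meson open_contains_ball)
  then show "\<exists>V. open V \<and> 0 \<in> V \<and> V \<subseteq> U \<and>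
       (\<forall>x\<in>V. \<forall>y\<in>V. \<forall>s\<ge>0. \<forall>t\<ge>0. s + t = 1 \<longrightarrow> s *\<^sub>R x + t *\<^sub>R y \<in> V)"
    using convex_ball[of "0::'a" e]
    by (intro exI[of _ "ball 0 e"]) (simp add: convex_def)
qed

text \<open>
  The space \<open>Y\<close> with \<open>\<plusminus>\<infinity>\<close> adjoined is \<^typ>\<open>'y extended\<close>; its negation and addition obey the
  usual conventions. The library totalises \<open>Pinf + Minf\<close> (as \<open>Pinf\<close>), but this sum never occurs
  for proper mappings and the sets considered here. Sums of sets are the elementwise ones
  of \<^theory>\<open>HOL-Library.Set_Algebras\<close>, whereas \<open>-\<close> on sets is set difference; hence the negative
  of a set \<open>A\<close> is written \<^term>\<open>uminus ` A\<close>.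
\<close>

definition ordering_cone :: "'y::lctvs set \<Rightarrow> bool" where
  "ordering_cone K \<longleftrightarrow> closed K \<and> convex K \<and> cone K \<and> interior K \<noteq> {} \<and> K \<noteq> UNIV"

fun less_cone :: "'y::lctvs set \<Rightarrow> 'y extended \<Rightarrow> 'y extended \<Rightarrow> bool" where
  "less_cone K (Fin a) (Fin b) \<longleftrightarrow> a - b \<in> uminus ` interior K"
| "less_cone K Minf (Fin b) \<longleftrightarrow> True"
| "less_cone K (Fin a) Pinf \<longleftrightarrow> True"
| "less_cone K Minf Pinf \<longleftrightarrow> True"
| "less_cone K _ _ \<longleftrightarrow> False"

fun le_cone :: "'y::lctvs set \<Rightarrow> 'y extended \<Rightarrow> 'y extended \<Rightarrow> bool" where
  "le_cone K (Fin a) (Fin b) \<longleftrightarrow> a - b \<in> uminus ` K"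
| "le_cone K Minf _ \<longleftrightarrow> True"
| "le_cone K _ Pinf \<longleftrightarrow> True"
| "le_cone K _ _ \<longleftrightarrow> False"

definition WSup :: "'y::lctvs set \<Rightarrow> 'y extended set \<Rightarrow> 'y extended set" where
  "WSup K M = {w. (\<forall>v\<in>M. \<not> less_cone K w v) \<and>
                  (\<forall>w'. less_cone K w' w \<longrightarrow> (\<exists>v\<in>M. less_cone K w' v))}"

definition set_prec :: "'y::lctvs set \<Rightarrow> 'y extended set \<Rightarrow> 'y extended set \<Rightarrow> bool" where
  "set_prec K M N \<longleftrightarrow> (\<forall>u\<in>M. \<forall>v\<in>N. \<not> less_cone K v u)"

text \<open>The members of \<open>Pp K\<close> are subsets of \<open>Y\<close>, embedded by \<^const>\<open>Fin\<close>.\<close>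

definition Pp :: "'y::lctvs set \<Rightarrow> 'y extended set set" where
  "Pp K = {Fin ` U |U.
     (U + uminus ` interior K) \<union> U \<union> (U + interior K) = UNIV \<and>
     (U + uminus ` interior K) \<inter> U = {} \<and>
     U \<inter> (U + interior K) = {} \<and>
     (U + uminus ` interior K) \<inter> (U + interior K) = {}}"

definition ws_sum :: "'y::lctvs set \<Rightarrow> 'y extended set \<Rightarrow> 'y extended set \<Rightarrow> 'y extended set" where
  "ws_sum K U V = WSup K (U + V)"

definition edom :: "('x \<Rightarrow> 'y extended) \<Rightarrow> 'x set" where
  "edom H = {x. H x \<noteq> Pinf}"

definition proper_ext :: "('x \<Rightarrow> 'y extended) \<Rightarrow> bool" where
  "proper_ext H \<longleftrightarrow> edom H \<noteq> {} \<and> Minf \<notin> range H"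

definition cone_convex :: "'y::lctvs set \<Rightarrow> ('x::lctvs \<Rightarrow> 'y extended) \<Rightarrow> bool" where
  "cone_convex K H \<longleftrightarrow> convex {(x, y). le_cone K (H x) (Fin y)}"

definition ext_continuous_at :: "('x::lctvs \<Rightarrow> 'y::lctvs extended) \<Rightarrow> 'x \<Rightarrow> bool" where
  "ext_continuous_at H x \<longleftrightarrow>
     (\<exists>y. H x = Fin y \<and>
          (\<forall>V. open V \<and> y \<in> V \<longrightarrow> (\<exists>U. open U \<and> x \<in> U \<and> H ` U \<subseteq> Fin ` V)))"

definition clin :: "('x::lctvs \<Rightarrow> 'y::lctvs) set" where
  "clin = {L. linear L \<and> continuous_on UNIV L}"

definition conj_map ::
  "'y::lctvs set \<Rightarrow> ('x::lctvs \<Rightarrow> 'y extended) \<Rightarrow> ('x \<Rightarrow> 'y) \<Rightarrow> 'y extended set" where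
  "conj_map K H L = WSup K (range (\<lambda>x. Fin (L x) - H x))"

definition conj_dom :: "'y::lctvs set \<Rightarrow> ('x::lctvs \<Rightarrow> 'y extended) \<Rightarrow> ('x \<Rightarrow> 'y) set" where
  "conj_dom K H = {L \<in> clin. conj_map K H L \<noteq> {Pinf}}"

definition epi_conj :: "'y::lctvs set \<Rightarrow> ('x::lctvs \<Rightarrow> 'y extended) \<Rightarrow> (('x \<Rightarrow> 'y) \<times> 'y) set" where
  "epi_conj K H = {(L, y). L \<in> clin \<and> Fin y \<in> conj_map K H L + Fin ` K}"

definition Epi_conj ::
  "'y::lctvs set \<Rightarrow> ('x::lctvs \<Rightarrow> 'y extended) \<Rightarrow> (('x \<Rightarrow> 'y) \<times> 'y extended set) set" where
  "Epi_conj K H = {(L, U). U \<in> Pp K \<and> L \<in> conj_dom K H \<and> set_prec K (conj_map K H L) U}"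

definition boxplus ::
  "'y::lctvs set \<Rightarrow> (('x::lctvs \<Rightarrow> 'y) \<times> 'y extended set) set \<Rightarrow>
   (('x \<Rightarrow> 'y) \<times> 'y extended set) set \<Rightarrow> (('x \<Rightarrow> 'y) \<times> 'y extended set) set" where
  "boxplus K M1 M2 =
     {(\<lambda>x. L1 x + L2 x, ws_sum K U1 U2) |L1 U1 L2 U2.
        (L1, U1) \<in> M1 \<and> (L2, U2) \<in> M2 \<and> ws_sum K U1 U2 \<in> Pp K}"

definition Psi :: "(('x \<Rightarrow> 'y) \<times> 'y extended set) set \<Rightarrow> (('x \<Rightarrow> 'y) \<times> 'y) set" where
  "Psi M = (\<Union>(L, U)\<in>M. {L} \<times> Fin -` U)"

end

theory Submission
  imports Defs
begin

text \<open>
  For a proper mapping \<open>H\<close> and a continuous linear \<open>L\<close> let \<open>D(H, L)\<close> be the open down-set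
  \<open>{L x - H x | x \<in> dom H} - int K\<close>. Every line in a direction of \<open>int K\<close> leaves a nonempty proper
  down-set through exactly one frontier point, and the finite part of a weak supremum is this
  frontier. Consequently \<open>(L, y)\<close> lies in the epigraph of \<open>H\<^sup>*\<close> iff \<open>y \<notin> D(H, L)\<close>
  (\<open>epi_conj_iff\<close>), and \<open>(L, U)\<close> lies in the extended epigraph iff the surface \<open>U\<close> does not meet
  \<open>D(H, L)\<close> (\<open>Epi_conj_iff\<close>). In this language the conjugates disappear.

  The easy inclusions: every value \<open>L\<^sub>i x - F\<^sub>i x\<close> is dominated by a point of \<open>U\<^sub>i\<close>, so
  no point of \<open>U\<^sub>1 \<uplus> U\<^sub>2\<close> can lie strictly below the sum of two such values
  (\<open>ws_sum_Epi_conj_not_below\<close>). This places the box sum of two extended epigraphs inside the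
  extended epigraph of the sum of the mappings.

  The hard inclusions need one separation argument (\<open>vector_sandwich\<close>, \<open>conjugate_sum_splitting\<close>).
  Suppose that no \<open>L x - F\<^sub>1 x - F\<^sub>2 x + a\<close>, with \<open>a\<close> in a convex set \<open>A\<close>, exceeds \<open>y\<close> by an element
  of \<open>int K\<close>. Then in \<open>X \<times> Y\<close> the convex set of all
  \<open>(x - x', L x' - h\<^sub>1 - h\<^sub>2 + a - y)\<close>, with \<open>(x, h\<^sub>1)\<close> and \<open>(x', h\<^sub>2)\<close> in the epigraphs
  of \<open>F\<^sub>1\<close> and \<open>F\<^sub>2\<close>, is disjoint from \<open>{0} \<times> int K\<close>, and the boundedness of \<open>F\<^sub>2\<close> near a point of
  the domain of \<open>F\<^sub>1\<close> makes \<open>(0, k)\<close>, \<open>k \<in> int K\<close>, an order unit of the cone to be separated. The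
  separating functional has the form \<open>(u, v) \<mapsto> e u + f v\<close> with \<open>f\<close> positive on \<open>int K\<close>. Normalised
  by \<open>f k = 1\<close>, it splits \<open>L\<close> into \<open>L\<^sub>1 x = e x k\<close> and \<open>L\<^sub>2 = L - L\<^sub>1\<close>, and the level sets of
  \<open>f\<close> at the right heights are surfaces that miss \<open>D(F\<^sub>1, L\<^sub>1)\<close> and \<open>D(F\<^sub>2, L\<^sub>2)\<close>. Parallel
  hyperplanes add up like their heights, so the required point \<open>y\<close> lies on the sum.

  With \<open>A = {0}\<close> this is the formula for two mappings (\<open>epi_conj_add\<close>). With
  \<open>A = {L\<^sub>3 x - h | (x, h)}\<close> over the epigraph of \<open>F\<^sub>3\<close> it is the comparison of the two triple
  sums (\<open>Psi_boxplus_add\<close>): the given surfaces may be far from convex, but the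
  down-sets that they avoid are convex, and a single functional separates the sum of these down-sets
  from \<open>y\<close>, which allows the replacement of the surfaces by parallel hyperplanes.
  The three-term formula for epigraphs applies the two-term one to \<open>F\<^sub>1 + F\<^sub>2\<close> and \<open>F\<^sub>3\<close>, in either order.
\<close>

section \<open>Hahn--Banach separation from an order unit\<close>

text \<open>
  The homogeneity clause is an inequality because that is what infima inherit directly; equality
  follows by applying it to the inverse factor.
\<close>

definition sublinear :: "('a::real_vector \<Rightarrow> real) \<Rightarrow> bool" where
  "sublinear p \<longleftrightarrow> (\<forall>x y. p (x + y) \<le> p x + p y) \<and> (\<forall>c>0. \<forall>x. p (c *\<^sub>R x) \<le> c * p x)"

lemma sublinear_zero: "sublinear p \<Longrightarrow> p 0 = 0"
proof -
  assume "sublinear p"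
  then have "p ((1/2) *\<^sub>R 0) \<le> 1/2 * p 0" "p (2 *\<^sub>R 0) \<le> 2 * p 0"
    unfolding sublinear_def by (meson half_gt_zero_iff zero_less_one zero_less_numeral)+
  then show ?thesis by simp
qed

lemma sublinear_scale:
  assumes "sublinear p" "c \<ge> 0"
  shows "p (c *\<^sub>R x) = c * p x"
proof (cases "c = 0")
  case False
  with assms have c: "c > 0" by simp
  have "p (inverse c *\<^sub>R (c *\<^sub>R x)) \<le> inverse c * p (c *\<^sub>R x)"
    using assms(1) c unfolding sublinear_def by (meson positive_imp_inverse_positive)
  then have "c * p x \<le> p (c *\<^sub>R x)"
    using c by (simp add: field_simps)
  then show ?thesis using assms(1) c unfolding sublinear_def by (meson antisym)
qed (simp add: sublinear_zero[OF assms(1)])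

lemma sublinear_lower_bound:
  assumes "sublinear p"
  shows "p x - p (- y) \<le> p (x + y)"
proof -
  have "p ((x + y) + (- y)) \<le> p (x + y) + p (- y)"
    using assms unfolding sublinear_def by blast
  then show ?thesis by simp
qed

text \<open>
  The three sublinear functionals constructed below (the infimum of a chain, the directional
  reduction of a sublinear functional, the gauge of an order unit) are all pointwise infima; this
  isolates the common verification.
\<close>

lemma sublinear_Inf:
  fixes A :: "'a::real_vector \<Rightarrow> real set"
  assumes ne: "\<And>x. A x \<noteq> {}" and bdd: "\<And>x. bdd_below (A x)"
    and add: "\<And>x y s t. s \<in> A x \<Longrightarrow> t \<in> A y \<Longrightarrow> \<exists>r\<in>A (x + y). r \<le> s + t"
    and scale: "\<And>c x s. c > 0 \<Longrightarrow> s \<in> A x \<Longrightarrow> \<exists>r\<in>A (c *\<^sub>R x). r \<le> c * s"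
  shows "sublinear (\<lambda>x. Inf (A x))"
  unfolding sublinear_def
proof (intro conjI allI impI)
  fix x y
  have *: "Inf (A (x + y)) \<le> s + t" if "s \<in> A x" "t \<in> A y" for s t
    using add[OF that] bdd cInf_lower order_trans by metis
  have "Inf (A (x + y)) - t \<le> Inf (A x)" if "t \<in> A y" for t
    by (rule cInf_greatest[OF ne]) (use *[OF _ that] in \<open>simp add: diff_le_eq\<close>)
  then have "Inf (A (x + y)) - Inf (A x) \<le> Inf (A y)"
    by (intro cInf_greatest[OF ne]) (simp add: algebra_simps)
  then show "Inf (A (x + y)) \<le> Inf (A x) + Inf (A y)" by simp
next
  fix c :: real and x assume c: "c > 0"
  have "Inf (A (c *\<^sub>R x)) / c \<le> s" if "s \<in> A x" for s
  proof -
    have "Inf (A (c *\<^sub>R x)) \<le> c * s"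
      using scale[OF c that] bdd cInf_lower order_trans by metis
    then show ?thesis using c by (simp add: field_simps)
  qed
  then have "Inf (A (c *\<^sub>R x)) / c \<le> Inf (A x)"
    by (intro cInf_greatest[OF ne])
  then show "Inf (A (c *\<^sub>R x)) \<le> c * Inf (A x)"
    using c by (simp add: field_simps)
qed

text \<open>
  Minimality replaces the one-dimensional extension step of Hahn--Banach: for fixed \<open>y\<close> the
  reduction \<open>x \<mapsto> inf {q (x + t y) - t q y | t \<ge> 0}\<close> is sublinear and below \<open>q\<close>, hence equal to \<open>q\<close>,
  and \<open>t = 1\<close> gives superadditivity.
\<close>

lemma minimal_sublinear_linear:
  assumes q: "sublinear q" and min: "\<And>r. sublinear r \<Longrightarrow> r \<le> q \<Longrightarrow> r = q"
  shows "linear q"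
proof -
  have add_ge: "q x + q y \<le> q (x + y)" for x y
  proof -
    define A where "A x = (\<lambda>t. q (x + t *\<^sub>R y) - t * q y) ` {0..}" for x
    have bdd: "bdd_below (A x)" for x
    proof (rule bdd_belowI)
      fix s assume "s \<in> A x"
      then obtain t where t: "t \<ge> 0" "s = q (x + t *\<^sub>R y) - t * q y" unfolding A_def by auto
      have "q (t *\<^sub>R y) - q (- x) \<le> q (t *\<^sub>R y + x)" by (rule sublinear_lower_bound[OF q])
      then show "- q (- x) \<le> s"
        using t by (simp add: sublinear_scale[OF q] add.commute)
    qed
    have "sublinear (\<lambda>x. Inf (A x))"
    proof (rule sublinear_Inf)
      fix u v a b assume "a \<in> A u" "b \<in> A v"
      then obtain s t where st: "s \<ge> 0" "t \<ge> 0"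
        "a = q (u + s *\<^sub>R y) - s * q y" "b = q (v + t *\<^sub>R y) - t * q y"
        unfolding A_def by auto
      have "q ((u + s *\<^sub>R y) + (v + t *\<^sub>R y)) \<le> q (u + s *\<^sub>R y) + q (v + t *\<^sub>R y)"
        using q unfolding sublinear_def by blast
      moreover have "(u + s *\<^sub>R y) + (v + t *\<^sub>R y) = (u + v) + (s + t) *\<^sub>R y"
        by (simp add: algebra_simps)
      ultimately have "q ((u + v) + (s + t) *\<^sub>R y) - (s + t) * q y \<le> a + b"
        using st by (simp add: algebra_simps)
      moreover have "s + t \<in> {0..}" using st by simp
      ultimately show "\<exists>r\<in>A (u + v). r \<le> a + b" unfolding A_def by blast
    next
      fix c :: real and u a assume c: "c > 0" and "a \<in> A u"
      then obtain s where s: "s \<ge> 0" "a = q (u + s *\<^sub>R y) - s * q y" unfolding A_def by auto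
      have "q (c *\<^sub>R (u + s *\<^sub>R y)) = c * q (u + s *\<^sub>R y)"
        using c by (simp add: sublinear_scale[OF q])
      moreover have "c * a = c * q (u + s *\<^sub>R y) - (c * s) * q y"
        unfolding s(2) by (simp add: algebra_simps)
      ultimately have "q (c *\<^sub>R u + (c * s) *\<^sub>R y) - (c * s) * q y \<le> c * a"
        by (simp add: scaleR_right_distrib)
      moreover have "c * s \<in> {0..}" using s c by simp
      ultimately show "\<exists>r\<in>A (c *\<^sub>R u). r \<le> c * a" unfolding A_def by blast
    qed (use bdd in \<open>auto simp: A_def\<close>)
    moreover have le: "Inf (A x) \<le> q (x + t *\<^sub>R y) - t * q y" if "t \<ge> 0" for x t
      by (rule cInf_lower[OF _ bdd]) (use that in \<open>auto simp: A_def\<close>)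
    moreover have "(\<lambda>x. Inf (A x)) \<le> q"
      using le[of 0] by (auto simp: le_fun_def)
    ultimately have "(\<lambda>x. Inf (A x)) = q" using min by blast
    then have "q x = Inf (A x)" by metis
    with le[of 1 x] show ?thesis by simp
  qed
  have add: "q (x + y) = q x + q y" for x y
    using add_ge[of x y] q unfolding sublinear_def by (meson antisym)
  show ?thesis
  proof (rule linearI)
    fix c :: real and x
    show "q (c *\<^sub>R x) = c *\<^sub>R q x"
    proof (cases "c \<ge> 0")
      case False
      have "q (c *\<^sub>R x) + q ((- c) *\<^sub>R x) = q 0"
        using add[of "c *\<^sub>R x" "(- c) *\<^sub>R x"] by simp
      then show ?thesis
        using False sublinear_scale[OF q, of "- c" x] sublinear_zero[OF q] by simp
    qed (simp add: sublinear_scale[OF q])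
  qed (rule add)
qed

text \<open>
  Zorn's lemma on sublinear functionals below \<open>p\<close>, ordered downwards. Every such \<open>q\<close> satisfies
  \<open>q x \<ge> - p (- x)\<close>, so that chains have pointwise infima.
\<close>

lemma sublinear_dominates_linear:
  fixes p :: "'a::real_vector \<Rightarrow> real"
  assumes p: "sublinear p"
  shows "\<exists>f. linear f \<and> f \<le> p"
proof -
  define S where "S = {q. sublinear q \<and> q \<le> p}"
  have "\<exists>m\<in>S. \<forall>a\<in>S. m \<ge> a \<longrightarrow> a = m"
  proof (rule predicate_Zorn)
    show "partial_order_on S (relation_of (\<ge>) S)"
      by (rule partial_order_on_relation_ofI) auto
  next
    fix C assume C: "C \<in> Chains (relation_of (\<ge>) S)"
    then have CS: "C \<subseteq> S" by (auto simp: Chains_def relation_of_def)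
    have chain: "a \<le> b \<or> b \<le> a" if "a \<in> C" "b \<in> C" for a b
      using C that by (auto simp: Chains_def relation_of_def)
    show "\<exists>u\<in>S. \<forall>a\<in>C. a \<ge> u"
    proof (cases "C = {}")
      case True
      then show ?thesis using p unfolding S_def by auto
    next
      case False
      define A where "A x = (\<lambda>q. q x) ` C" for x
      have bdd: "bdd_below (A x)" for x
      proof (rule bdd_belowI)
        fix s assume "s \<in> A x"
        then obtain q where q: "q \<in> C" "s = q x" unfolding A_def by auto
        with CS have "sublinear q" "q (- x) \<le> p (- x)" by (auto simp: S_def le_fun_def)
        then show "- p (- x) \<le> s"
          using sublinear_lower_bound[of q 0 x] sublinear_zero[of q] q by simp
      qed
      have low: "Inf (A x) \<le> q x" if "q \<in> C" for q x
        by (rule cInf_lower[OF _ bdd]) (use that in \<open>auto simp: A_def\<close>)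
      have "sublinear (\<lambda>x. Inf (A x))"
      proof (rule sublinear_Inf)
        fix u v a b assume "a \<in> A u" "b \<in> A v"
        then obtain q r where qr: "q \<in> C" "r \<in> C" "a = q u" "b = r v" unfolding A_def by auto
        obtain m where m: "m \<in> C" "m \<le> q" "m \<le> r" using chain[OF qr(1,2)] qr by blast
        have "m (u + v) \<le> m u + m v"
          using m CS unfolding S_def sublinear_def by blast
        also have "\<dots> \<le> a + b" using m qr by (auto simp: le_fun_def intro: add_mono)
        finally show "\<exists>r\<in>A (u + v). r \<le> a + b" using m unfolding A_def by auto
      next
        fix c :: real and u a assume "c > 0" "a \<in> A u"
        then show "\<exists>r\<in>A (c *\<^sub>R u). r \<le> c * a"
          using CS unfolding A_def S_def sublinear_def by fast
      qed (use False bdd in \<open>auto simp: A_def\<close>)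
      moreover have "(\<lambda>x. Inf (A x)) \<le> p"
      proof -
        obtain q where q: "q \<in> C" using False by blast
        then have "q \<le> p" using CS by (auto simp: S_def)
        then show ?thesis using low[OF q] by (auto simp: le_fun_def intro: order_trans)
      qed
      ultimately have "(\<lambda>x. Inf (A x)) \<in> S" by (simp add: S_def)
      then show ?thesis using low by (intro bexI[of _ "\<lambda>x. Inf (A x)"]) (auto simp: le_fun_def)
    qed
  qed
  then obtain m where m: "m \<in> S" "\<And>a. a \<in> S \<Longrightarrow> a \<le> m \<Longrightarrow> a = m" by blast
  have "linear m"
  proof (rule minimal_sublinear_linear)
    show "sublinear m" using m(1) by (simp add: S_def)
    show "r = m" if "sublinear r" "r \<le> m" for r
      using m that order_trans by (auto simp: S_def)
  qed
  then show ?thesis using m(1) by (auto simp: S_def)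
qed

text \<open>
  The gauge \<open>x \<mapsto> inf {t | t e - x \<in> P}\<close> is finite because \<open>e\<close> is an order unit and \<open>- e \<notin> P\<close>;
  a linear functional below it is nonnegative on \<open>P\<close>.
\<close>

lemma order_unit_separation:
  fixes P :: "'a::real_vector set"
  assumes add: "\<And>x y. x \<in> P \<Longrightarrow> y \<in> P \<Longrightarrow> x + y \<in> P"
    and scale: "\<And>c x. c > 0 \<Longrightarrow> x \<in> P \<Longrightarrow> c *\<^sub>R x \<in> P"
    and unit: "\<And>x. \<exists>s. x + s *\<^sub>R e \<in> P"
    and "0 \<in> P" "- e \<notin> P"
  shows "\<exists>f. linear f \<and> f e = (1::real) \<and> (\<forall>x\<in>P. f x \<ge> 0)"
proof -
  define A where "A x = {t. t *\<^sub>R e - x \<in> P}" for x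
  have low: "- s \<le> t" if "x + s *\<^sub>R e \<in> P" "t \<in> A x" for s t x
  proof (rule ccontr)
    assume "\<not> - s \<le> t"
    then have pos: "inverse (- (s + t)) > 0" by simp
    have "(x + s *\<^sub>R e) + (t *\<^sub>R e - x) \<in> P"
      using that by (intro add[OF that(1)]) (simp add: A_def)
    moreover have "(x + s *\<^sub>R e) + (t *\<^sub>R e - x) = (s + t) *\<^sub>R e"
      by (simp add: algebra_simps)
    ultimately have "(s + t) *\<^sub>R e \<in> P" by simp
    from scale[OF pos this] have "(inverse (- (s + t)) * (s + t)) *\<^sub>R e \<in> P" by simp
    moreover have "inverse (- (s + t)) * (s + t) = - 1" using pos by (simp add: field_simps)
    ultimately show False using \<open>- e \<notin> P\<close> by simp
  qed
  have bdd: "bdd_below (A x)" for x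
    using unit[of x] low bdd_belowI by metis
  have "sublinear (\<lambda>x. Inf (A x))"
  proof (rule sublinear_Inf)
    fix x
    obtain s where "- x + s *\<^sub>R e \<in> P" using unit by blast
    then show "A x \<noteq> {}" by (auto simp: A_def)
  next
    fix x y s t assume "s \<in> A x" "t \<in> A y"
    then have "s *\<^sub>R e - x + (t *\<^sub>R e - y) \<in> P" using add by (auto simp: A_def)
    then have "s + t \<in> A (x + y)" by (simp add: A_def algebra_simps)
    then show "\<exists>r\<in>A (x + y). r \<le> s + t" by blast
  next
    fix c :: real and x s assume "c > 0" "s \<in> A x"
    then have "c *\<^sub>R (s *\<^sub>R e - x) \<in> P" using scale by (auto simp: A_def)
    then have "c * s \<in> A (c *\<^sub>R x)" by (simp add: A_def algebra_simps)
    then show "\<exists>r\<in>A (c *\<^sub>R x). r \<le> c * s" by blast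
  qed (rule bdd)
  then obtain f where f: "linear f" "f \<le> (\<lambda>x. Inf (A x))" using sublinear_dominates_linear by blast
  have le: "f x \<le> t" if "t *\<^sub>R e - x \<in> P" for x t
  proof -
    have "f x \<le> Inf (A x)" using f(2) by (simp add: le_fun_def)
    also have "\<dots> \<le> t" by (rule cInf_lower[OF _ bdd]) (use that in \<open>simp add: A_def\<close>)
    finally show ?thesis .
  qed
  have pos: "f x \<ge> 0" if "x \<in> P" for x
    using le[of 0 "- x"] that linear_neg[OF f(1), of x] by simp
  have "f e \<le> 1" "f (- e) \<le> - 1" using le[of 1 e] le[of "- 1" "- e"] \<open>0 \<in> P\<close> by auto
  then have "f e = 1" using linear_neg[OF f(1), of e] by simp
  then show ?thesis using f(1) pos by blast
qed

section \<open>Locally convex spaces\<close>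

lemma tendsto_scaleR_lctvs:
  fixes g :: "'b \<Rightarrow> 'a::lctvs"
  assumes "(f \<longlongrightarrow> c) F" "(g \<longlongrightarrow> x) F"
  shows "((\<lambda>z. f z *\<^sub>R g z) \<longlongrightarrow> c *\<^sub>R x) F"
  using filterlim_compose[OF tendsto_scaleR_nhds filterlim_Pair[OF assms]] by simp

lemma open_scaleR_lctvs:
  fixes S :: "'a::lctvs set"
  assumes "open S" "c > 0"
  shows "open ((\<lambda>x. c *\<^sub>R x) ` S)"
proof -
  have "continuous_on UNIV (\<lambda>x::'a. inverse c *\<^sub>R x)"
    by (auto simp: continuous_on_def intro: tendsto_scaleR_lctvs)
  then have "open ((\<lambda>x::'a. inverse c *\<^sub>R x) -` S)" using assms(1) by (simp add: open_vimage)
  moreover have "(\<lambda>x::'a. inverse c *\<^sub>R x) -` S = (\<lambda>x. c *\<^sub>R x) ` S"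
    using assms(2) by (force simp: image_iff)
  ultimately show ?thesis by simp
qed

text \<open>
  Continuity of scalar multiplication in the scalar: open sets contain an initial piece of every
  ray that starts in them.
\<close>

lemma open_lctvs_absorbs:
  fixes S :: "'a::lctvs set"
  assumes "open S" "x \<in> S"
  shows "\<exists>r>0. \<forall>s. 0 \<le> s \<and> s \<le> r \<longrightarrow> x + s *\<^sub>R v \<in> S"
proof -
  have "((\<lambda>s. x + s *\<^sub>R v) \<longlongrightarrow> x + 0 *\<^sub>R v) (at_right (0::real))"
    by (intro tendsto_add tendsto_const tendsto_scaleR_lctvs tendsto_ident_at)
  then have "\<forall>\<^sub>F s in at_right 0. x + s *\<^sub>R v \<in> S"
    using assms by (auto simp: tendsto_def)
  then obtain b where b: "b > (0::real)" "\<And>s. 0 < s \<Longrightarrow> s < b \<Longrightarrow> x + s *\<^sub>R v \<in> S"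
    by (auto simp: eventually_at_right_field)
  show ?thesis
  proof (intro exI[of _ "b/2"] conjI allI impI)
    fix s assume "0 \<le> s \<and> s \<le> b/2"
    then show "x + s *\<^sub>R v \<in> S" using b assms(2) by (cases "s = 0") auto
  qed (use b in simp)
qed

text \<open>
  If \<open>f\<close> is less than \<open>d\<close> above \<open>f x0\<close> on a neighbourhood of \<open>x0\<close>, then shrinking that
  neighbourhood by \<open>e / d\<close> around \<open>a\<close>, together with its reflection, bounds \<open>\<bar>f x - f a\<bar>\<close> by \<open>e\<close>.
\<close>

lemma continuous_linear_functional:
  fixes f :: "'a::lctvs \<Rightarrow> real"
  assumes f: "linear f" and U: "open U" "x0 \<in> U" and bd: "\<And>x. x \<in> U \<Longrightarrow> f x \<le> c"
  shows "continuous_on UNIV f"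
proof -
  define d where "d = \<bar>c - f x0\<bar> + 1"
  have d: "d > 0" "\<And>x. x \<in> U \<Longrightarrow> f x - f x0 < d" using bd by (force simp: d_def)+
  have "(f \<longlongrightarrow> f a) (nhds a)" for a
  proof (rule tendstoI)
    fix e :: real assume e: "e > 0"
    \<comment> \<open>T 1 x and T (- 1) x are x and its reflection in a, moved from a to x0 and stretched by d / e.\<close>
    define T where "T s x = x0 + (s * d / e) *\<^sub>R (x - a)" for s x
    have ev: "\<forall>\<^sub>F x in nhds a. T s x \<in> U" for s
    proof -
      have "(T s \<longlongrightarrow> x0 + (s * d / e) *\<^sub>R (a - a)) (nhds a)"
        unfolding T_def diff_conv_add_uminus
        by (intro tendsto_add tendsto_const tendsto_scaleR_lctvs tendsto_minus) (simp add: filterlim_ident)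
      then show ?thesis using U by (auto simp: tendsto_def)
    qed
    have fT: "f (T s x) - f x0 = (s * d / e) * (f x - f a)" for s x
      using f by (simp add: T_def linear_add linear_scale linear_diff del: times_divide_eq_left)
    have "\<forall>\<^sub>F x in nhds a. T 1 x \<in> U \<and> T (- 1) x \<in> U"
      using ev by (simp add: eventually_conj)
    then show "\<forall>\<^sub>F x in nhds a. dist (f x) (f a) < e"
    proof (rule eventually_mono)
      fix x assume "T 1 x \<in> U \<and> T (- 1) x \<in> U"
      then have "f (T 1 x) - f x0 < d" "f (T (- 1) x) - f x0 < d" using d(2) by auto
      then have "(d / e) * (f x - f a) < d" "- (d / e) * (f x - f a) < d"
        unfolding fT by simp_all
      moreover have "z < e" if "(d / e) * z < d" for z
        using that d(1) e by (simp add: divide_simps)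
      ultimately have "f x - f a < e" "- (f x - f a) < e" by (metis mult_minus_left mult_minus_right)+
      then show "dist (f x) (f a) < e" by (simp add: dist_real_def)
    qed
  qed
  then show ?thesis
    unfolding continuous_on_def by (meson at_within_le_nhds tendsto_mono)
qed

section \<open>The ordering cone and weak suprema\<close>

lemma less_cone_Fin_iff: "less_cone K (Fin a) (Fin b) \<longleftrightarrow> b - a \<in> interior K"
proof -
  have "a - b \<in> uminus ` interior K \<longleftrightarrow> - (a - b) \<in> interior K" by (metis image_iff minus_minus)
  then show ?thesis by simp
qed

declare less_cone.simps(1) [simp del] less_cone_Fin_iff [simp]

locale ordered_lctvs =
  fixes K :: "'y::lctvs set"
  assumes K: "ordering_cone K"
begin

lemma cone_add: "x \<in> K \<Longrightarrow> y \<in> K \<Longrightarrow> x + y \<in> K"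
  using K convex_cone[of K] unfolding ordering_cone_def by blast

lemma cone_scale: "x \<in> K \<Longrightarrow> c \<ge> 0 \<Longrightarrow> c *\<^sub>R x \<in> K"
  using K by (simp add: ordering_cone_def cone_def)

lemma interior_subset_cone: "x \<in> interior K \<Longrightarrow> x \<in> K"
  using interior_subset by blast

lemma zero_in_cone: "0 \<in> K"
proof -
  obtain k where "k \<in> K" using K interior_subset unfolding ordering_cone_def by fastforce
  from cone_scale[OF this, of 0] show ?thesis by simp
qed

lemma interior_cone_add:
  assumes "x \<in> interior K" "y \<in> K"
  shows "x + y \<in> interior K"
proof (rule interiorI)
  show "open ((\<lambda>z. z - y) -` interior K)"
    by (intro open_vimage open_interior)
      (auto simp: continuous_on_def diff_conv_add_uminus simp del: add_uminus_conv_diff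
            intro!: tendsto_add tendsto_const)
  show "x + y \<in> (\<lambda>z. z - y) -` interior K" using assms by simp
  show "(\<lambda>z. z - y) -` interior K \<subseteq> K"
  proof
    fix z assume "z \<in> (\<lambda>z. z - y) -` interior K"
    then have "(z - y) + y \<in> K" using assms cone_add interior_subset_cone by blast
    then show "z \<in> K" by simp
  qed
qed

lemma interior_cone_scale:
  assumes "x \<in> interior K" "c > 0"
  shows "c *\<^sub>R x \<in> interior K"
proof (rule interiorI)
  show "open ((\<lambda>x. c *\<^sub>R x) ` interior K)" by (simp add: open_scaleR_lctvs assms)
  show "(\<lambda>x. c *\<^sub>R x) ` interior K \<subseteq> K"
    using assms cone_scale interior_subset_cone by (auto intro: less_imp_le)
qed (use assms in simp)

lemma interior_cone_shrink:
  assumes "x \<in> interior K"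
  shows "\<exists>r>0. x - r *\<^sub>R v \<in> interior K"
proof -
  obtain r where "r > 0" "\<forall>s. 0 \<le> s \<and> s \<le> r \<longrightarrow> x + s *\<^sub>R (- v) \<in> interior K"
    using open_lctvs_absorbs[OF open_interior assms] by blast
  then show ?thesis by (intro exI[of _ r]) auto
qed

text \<open>
  Interior points of \<open>K\<close> are order units of the ordered space; the separation argument in the
  product space rests on this.
\<close>

lemma interior_cone_order_unit:
  assumes "k0 \<in> interior K"
  shows "\<exists>t>0. x + t *\<^sub>R k0 \<in> interior K"
proof -
  obtain r where r: "r > 0" "k0 - r *\<^sub>R (- x) \<in> interior K"
    using interior_cone_shrink[OF assms] by blast
  have "inverse r *\<^sub>R (k0 - r *\<^sub>R (- x)) = x + inverse r *\<^sub>R k0"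
    using r(1) by (simp add: scaleR_right_distrib)
  then show ?thesis
    using interior_cone_scale[OF r(2), of "inverse r"] r(1) by (intro exI[of _ "inverse r"]) simp
qed

lemma neg_interior_notin_cone:
  assumes "k0 \<in> interior K"
  shows "- k0 \<notin> K"
proof
  assume k: "- k0 \<in> K"
  have "x \<in> K" for x
  proof -
    obtain t where t: "t > 0" "x + t *\<^sub>R k0 \<in> interior K" using interior_cone_order_unit[OF assms] by blast
    have "t *\<^sub>R (- k0) \<in> K" using cone_scale[OF k] t less_imp_le by blast
    from cone_add[OF interior_subset_cone[OF t(2)] this] show ?thesis by simp
  qed
  then show False using K by (auto simp: ordering_cone_def)
qed

text \<open>
  If \<open>M\<close> is the set of values \<open>L x - H x\<close>, then \<open>below M\<close> is the set \<open>D(H, L)\<close> of the introduction.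
\<close>

definition below :: "'y extended set \<Rightarrow> 'y set" where
  "below M = {d. \<exists>m. Fin m \<in> M \<and> m - d \<in> interior K}"

definition frontier_below :: "'y extended set \<Rightarrow> 'y set" where
  "frontier_below M = {w. w \<notin> below M \<and> (\<forall>i\<in>interior K. w - i \<in> below M)}"

lemma belowI: "Fin m \<in> M \<Longrightarrow> m - d \<in> interior K \<Longrightarrow> d \<in> below M"
  by (auto simp: below_def)

lemma below_downward: "d \<in> below M \<Longrightarrow> k \<in> K \<Longrightarrow> d - k \<in> below M"
proof -
  assume "d \<in> below M" "k \<in> K"
  then obtain m where "Fin m \<in> M" "(m - d) + k \<in> interior K"
    using interior_cone_add unfolding below_def by blast
  moreover have "m - d + k = m - (d - k)" for m by simp
  ultimately show ?thesis unfolding below_def by auto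
qed


lemma WSup_Fin_iff:
  assumes M: "Pinf \<notin> M" "Fin m \<in> M"
  shows "Fin w \<in> WSup K M \<longleftrightarrow> w \<in> frontier_below M"
proof -
  have upper: "(\<forall>v\<in>M. \<not> less_cone K (Fin w) v) \<longleftrightarrow> w \<notin> below M"
  proof -
    have "less_cone K (Fin w) v \<longleftrightarrow> (\<exists>a. v = Fin a \<and> a - w \<in> interior K)" if "v \<in> M" for v
      using that M(1) by (cases v) auto
    then show ?thesis unfolding below_def by blast
  qed
  have dense: "(\<exists>v\<in>M. less_cone K (Fin a) v) \<longleftrightarrow> a \<in> below M" for a
  proof -
    have "less_cone K (Fin a) v \<longleftrightarrow> (\<exists>b. v = Fin b \<and> b - a \<in> interior K)" if "v \<in> M" for v
      using that M(1) by (cases v) auto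
    then show ?thesis unfolding below_def by blast
  qed
  have "(\<forall>w'. less_cone K w' (Fin w) \<longrightarrow> (\<exists>v\<in>M. less_cone K w' v)) \<longleftrightarrow>
      (\<forall>i\<in>interior K. w - i \<in> below M)" (is "?l = ?r")
  proof
    assume l: ?l
    show ?r
    proof
      fix i assume "i \<in> interior K"
      then have "less_cone K (Fin (w - i)) (Fin w)" by simp
      then show "w - i \<in> below M" using l dense by blast
    qed
  next
    assume r: ?r
    show ?l
    proof (intro allI impI)
      fix w' assume w': "less_cone K w' (Fin w)"
      show "\<exists>v\<in>M. less_cone K w' v"
      proof (cases w')
        case (Fin a)
        then have "w - (w - a) \<in> below M" using w' r less_cone_Fin_iff by blast
        then show ?thesis using dense Fin by simp
      next
        case Minf
        then show ?thesis using M(2) less_cone.simps(2) by blast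
      next
        case Pinf
        then show ?thesis using w' by simp
      qed
    qed
  qed
  then show ?thesis using upper unfolding WSup_def frontier_below_def by simp
qed

text \<open>
  This covers the case excluded by the domain of a conjugate: no frontier exists.
\<close>

lemma WSup_eq_Pinf:
  assumes M: "Pinf \<notin> M" "Fin m \<in> M" and all: "below M = UNIV"
  shows "WSup K M = {Pinf}"
proof -
  have "Fin w \<notin> WSup K M" for w
    using WSup_Fin_iff[OF M] all by (simp add: frontier_below_def)
  moreover have "Minf \<notin> WSup K M"
  proof
    assume "Minf \<in> WSup K M"
    then have "\<not> less_cone K Minf (Fin m)" using M(2) unfolding WSup_def by blast
    then show False by simp
  qed
  moreover have "Pinf \<in> WSup K M"
    unfolding WSup_def mem_Collect_eq
  proof (intro conjI ballI allI impI)
    fix v show "\<not> less_cone K Pinf v" by (cases v) auto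
  next
    fix w' assume w': "less_cone K w' Pinf"
    show "\<exists>v\<in>M. less_cone K w' v"
    proof (cases w')
      case (Fin a)
      have "a \<in> below M" using all by simp
      then obtain b where "Fin b \<in> M" "b - a \<in> interior K" unfolding below_def by blast
      then show ?thesis using Fin less_cone_Fin_iff by blast
    next
      case Minf
      then show ?thesis using M(2) less_cone.simps(2) by blast
    next
      case Pinf
      then show ?thesis using w' by simp
    qed
  qed
  ultimately have "v \<in> WSup K M \<longleftrightarrow> v \<in> {Pinf}" for v by (cases v) auto
  then show ?thesis by blast
qed


text \<open>
  The line \<open>t \<mapsto> y + t k0\<close> lies in the down-set for small \<open>t\<close> and outside for large \<open>t\<close>; it crosses
  the frontier at the supremum of the admissible parameters.
\<close>

lemma line_meets_frontier:
  assumes k0: "k0 \<in> interior K" and M: "Fin m \<in> M" and z: "z \<notin> below M"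
  shows "\<exists>t. y + t *\<^sub>R k0 \<in> frontier_below M"
proof -
  define T where "T = {t. y + t *\<^sub>R k0 \<in> below M}"
  have down: "s \<in> T" if "t \<in> T" "s \<le> t" for s t
  proof -
    have "(t - s) *\<^sub>R k0 \<in> K" using that k0 by (intro cone_scale interior_subset_cone) auto
    moreover have "y + t *\<^sub>R k0 \<in> below M" using that(1) by (simp add: T_def)
    ultimately have "y + t *\<^sub>R k0 - (t - s) *\<^sub>R k0 \<in> below M" by (rule below_downward[rotated])
    then show ?thesis by (simp add: T_def scaleR_left_diff_distrib)
  qed
  obtain s where s: "(m - y) + s *\<^sub>R k0 \<in> interior K" 
    using interior_cone_order_unit[OF k0] by blast
  moreover have "m - (y + (- s) *\<^sub>R k0) = (m - y) + s *\<^sub>R k0" by simp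
  ultimately have sT: "- s \<in> T" using belowI[OF M] unfolding T_def by (metis mem_Collect_eq)
  obtain u where u: "(y - z) + u *\<^sub>R k0 \<in> interior K"
    using interior_cone_order_unit[OF k0] by blast
  have uT: "u \<notin> T"
  proof
    assume "u \<in> T"
    then have "y + u *\<^sub>R k0 \<in> below M" by (simp add: T_def)
    then have "(y + u *\<^sub>R k0) - ((y - z) + u *\<^sub>R k0) \<in> below M"
      using u below_downward interior_subset_cone by blast
    then show False using z by simp
  qed
  have bdd: "bdd_above T" using uT down linear by (intro bdd_aboveI[of _ u]) blast
  define t where "t = Sup T"
  have lt: "r \<in> T" if "r < t" for r
  proof -
    obtain a where "a \<in> T" "r < a" using less_cSup_iff[of T r] bdd sT \<open>r < t\<close> unfolding t_def by blast
    then show ?thesis using down by simp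
  qed
  \<comment> \<open>The down-set is open, so the supremum itself is not attained.\<close>
  have "t \<notin> T"
  proof
    assume "t \<in> T"
    then obtain a where a: "Fin a \<in> M" "a - (y + t *\<^sub>R k0) \<in> interior K"
      unfolding T_def below_def by auto
    then obtain r where r: "r > 0" "a - (y + t *\<^sub>R k0) - r *\<^sub>R k0 \<in> interior K"
      using interior_cone_shrink by blast
    moreover have "a - (y + (t + r) *\<^sub>R k0) = a - (y + t *\<^sub>R k0) - r *\<^sub>R k0"
      by (simp add: scaleR_left_distrib)
    ultimately have "t + r \<in> T" using belowI[OF a(1)] unfolding T_def by (metis mem_Collect_eq)
    then have "t + r \<le> t" unfolding t_def by (rule cSup_upper[OF _ bdd])
    then show False using r by simp
  qed
  moreover have "y + t *\<^sub>R k0 - i \<in> below M" if i: "i \<in> interior K" for i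
  proof -
    obtain r where r: "r > 0" "i - r *\<^sub>R k0 \<in> interior K" using interior_cone_shrink[OF i] by blast
    have "t - r \<in> T" using lt r by simp
    then have "y + (t - r) *\<^sub>R k0 \<in> below M" by (simp add: T_def)
    then have "(y + (t - r) *\<^sub>R k0) - (i - r *\<^sub>R k0) \<in> below M"
      using r below_downward interior_subset_cone by blast
    then show ?thesis by (simp add: scaleR_left_diff_distrib)
  qed
  ultimately show ?thesis by (auto simp: frontier_below_def T_def)
qed

text \<open>
  On the line through \<open>y\<close> the frontier parameter is nonpositive exactly when \<open>y\<close> is outside the
  down-set. This and the next lemma are the two halves of that sign rule.
\<close>

lemma above_frontier_iff:
  assumes M: "Fin m \<in> M"
  shows "y \<notin> below M \<longleftrightarrow> (\<exists>w\<in>frontier_below M. y - w \<in> K)"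
proof
  assume y: "y \<notin> below M"
  obtain k0 where k0: "k0 \<in> interior K" using K by (auto simp: ordering_cone_def)
  obtain t where t: "y + t *\<^sub>R k0 \<in> frontier_below M" using line_meets_frontier[OF k0 M y] by blast
  have "t \<le> 0"
  proof (rule ccontr)
    assume "\<not> t \<le> 0"
    then have "t *\<^sub>R k0 \<in> interior K" by (intro interior_cone_scale k0) simp
    then have "y + t *\<^sub>R k0 - t *\<^sub>R k0 \<in> below M"
      using t unfolding frontier_below_def by blast
    then show False using y by simp
  qed
  then have "(- t) *\<^sub>R k0 \<in> K" using k0 by (intro cone_scale interior_subset_cone) auto
  then show "\<exists>w\<in>frontier_below M. y - w \<in> K" using t by (intro bexI) auto
next
  assume "\<exists>w\<in>frontier_below M. y - w \<in> K"
  then obtain w where w: "w \<in> frontier_below M" "y - w \<in> K" by blast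
  show "y \<notin> below M"
  proof
    assume "y \<in> below M"
    from below_downward[OF this w(2)] show False using w(1) by (simp add: frontier_below_def)
  qed
qed

lemma below_frontier:
  assumes M: "Fin m \<in> M" and z: "z \<notin> below M" and d: "d \<in> below M"
  shows "\<exists>w\<in>frontier_below M. w - d \<in> interior K"
proof -
  obtain k0 where k0: "k0 \<in> interior K" using K by (auto simp: ordering_cone_def)
  obtain t where t: "d + t *\<^sub>R k0 \<in> frontier_below M" using line_meets_frontier[OF k0 M z] by blast
  have "t > 0"
  proof (rule ccontr)
    assume "\<not> t > 0"
    then have "(- t) *\<^sub>R k0 \<in> K" using k0 by (intro cone_scale interior_subset_cone) auto
    from below_downward[OF d this] show False using t by (simp add: frontier_below_def)
  qed
  then have "(d + t *\<^sub>R k0) - d \<in> interior K" using interior_cone_scale[OF k0] by simp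
  then show ?thesis using t by blast
qed

end

section \<open>A vector-valued sandwich theorem\<close>

lemma clin_add: "L1 \<in> clin \<Longrightarrow> L2 \<in> clin \<Longrightarrow> (\<lambda>x. L1 x + L2 x) \<in> clin"
  by (auto simp: clin_def continuous_on_def linear_compose_add intro!: tendsto_add)

lemma clin_diff: "L1 \<in> clin \<Longrightarrow> L2 \<in> clin \<Longrightarrow> (\<lambda>x. L1 x - L2 x) \<in> clin"
  using clin_add[of L1 "\<lambda>x. - L2 x"]
  by (auto simp: clin_def continuous_on_def linear_compose_neg intro!: tendsto_minus)

lemma clin_rank_one:
  fixes f :: "'a::lctvs \<Rightarrow> real"
  assumes "linear f" "continuous_on UNIV f"
  shows "(\<lambda>x. f x *\<^sub>R (v::'b::lctvs)) \<in> clin"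
  using assms
  by (auto simp: clin_def continuous_on_def linear_add linear_scale scaleR_left_distrib
      intro!: linearI tendsto_scaleR_lctvs)

text \<open>
  The heights of the three hyperplanes used later: two suprema, and a remainder for the third, so
  that the heights sum to \<open>c\<close> with equality.
\<close>

lemma split_upper_bound:
  fixes S1 S2 S3 :: "real set"
  assumes ne: "S1 \<noteq> {}" "S2 \<noteq> {}" "S3 \<noteq> {}"
    and bound: "\<And>s1 s2 s3. s1 \<in> S1 \<Longrightarrow> s2 \<in> S2 \<Longrightarrow> s3 \<in> S3 \<Longrightarrow> s1 + s2 + s3 \<le> c"
  obtains a1 a2 a3 where "\<And>s. s \<in> S1 \<Longrightarrow> s \<le> a1" "\<And>s. s \<in> S2 \<Longrightarrow> s \<le> a2"
    "\<And>s. s \<in> S3 \<Longrightarrow> s \<le> a3" "a1 + a2 + a3 = c"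
proof -
  obtain t1 t2 t3 where t: "t1 \<in> S1" "t2 \<in> S2" "t3 \<in> S3" using ne by blast
  have b1: "bdd_above S1" using bound[OF _ t(2,3)] by (intro bdd_aboveI[of _ "c - t2 - t3"]) force
  have b2: "bdd_above S2" using bound[OF t(1) _ t(3)] by (intro bdd_aboveI[of _ "c - t1 - t3"]) force
  have "Sup S1 \<le> c - s2 - s3" if "s2 \<in> S2" "s3 \<in> S3" for s2 s3
    using bound[OF _ that] by (intro cSup_least ne(1)) force
  then have "s2 \<le> c - Sup S1 - s3" if "s2 \<in> S2" "s3 \<in> S3" for s2 s3 using that by force
  then have "Sup S2 \<le> c - Sup S1 - s3" if "s3 \<in> S3" for s3
    using that by (intro cSup_least ne(2)) blast
  then show ?thesis
    using b1 b2 by (intro that[of "Sup S1" "Sup S2" "c - Sup S1 - Sup S2"])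
      (auto intro: cSup_upper simp: algebra_simps)
qed

context ordered_lctvs
begin

text \<open>
  One application of Hahn--Banach in \<open>X \<times> Y\<close>. The set \<open>C\<close> of all
  \<open>(x - x', L x' - h1 - h2 + a - y)\<close> is convex and misses \<open>{0} \<times> int K\<close> by \<open>sep\<close>; hence the
  cone \<open>P\<close> of all \<open>(0, k) - t c\<close> with \<open>k \<in> K\<close>, \<open>t \<ge> 0\<close>, \<open>c \<in> C\<close> does not contain \<open>- (0, k0)\<close>. A
  functional that is nonnegative on \<open>P\<close> is nonnegative on \<open>{0} \<times> K\<close> and nonpositive on \<open>C\<close>.
  Using two independent points \<open>x\<close>, \<open>x'\<close> is what later decouples \<open>G1\<close> from \<open>G2\<close>, and the bound \<open>b2\<close>
  around \<open>x0\<close> supplies every direction \<open>u\<close> in the first component, so that \<open>(0, k0)\<close> is an order unit.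
\<close>

lemma joint_separation:
  fixes G1 G2 :: "('x::lctvs \<times> 'y) set" and L :: "'x \<Rightarrow> 'y"
  assumes conv: "convex G1" "convex G2" "convex A" and L: "L \<in> clin" and k0: "k0 \<in> interior K"
    and x0: "(x0, b1) \<in> G1" and a0: "a0 \<in> A"
    and W: "open W" "x0 \<in> W" "\<And>x. x \<in> W \<Longrightarrow> (x, b2) \<in> G2"
    and sep: "\<And>x h1 h2 a. (x, h1) \<in> G1 \<Longrightarrow> (x, h2) \<in> G2 \<Longrightarrow> a \<in> A \<Longrightarrow>
      L x - h1 - h2 + a - y \<notin> interior K"
  shows "\<exists>f::'x \<times> 'y \<Rightarrow> real. linear f \<and> f (0, k0) = 1 \<and> (\<forall>k\<in>K. f (0, k) \<ge> 0) \<and>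
    (\<forall>(x, h1)\<in>G1. \<forall>(x', h2)\<in>G2. \<forall>a\<in>A. f (x - x', L x' - h1 - h2 + a - y) \<le> 0)"
proof -
  have linL: "linear L" using L by (simp add: clin_def)
  define C where "C = {(x - x', L x' - h1 - h2 + a - y) |x h1 x' h2 a.
    (x, h1) \<in> G1 \<and> (x', h2) \<in> G2 \<and> a \<in> A}"
  have convC: "convex C"
  proof (rule convexI)
    fix c d :: "'x \<times> 'y" and s t :: real
    assume cd: "c \<in> C" "d \<in> C" and st: "0 \<le> s" "0 \<le> t" "s + t = 1"
    obtain x h1 x' h2 a where c: "c = (x - x', L x' - h1 - h2 + a - y)"
      "(x, h1) \<in> G1" "(x', h2) \<in> G2" "a \<in> A" using cd(1) unfolding C_def by blast
    obtain z g1 z' g2 b where d: "d = (z - z', L z' - g1 - g2 + b - y)"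
      "(z, g1) \<in> G1" "(z', g2) \<in> G2" "b \<in> A" using cd(2) unfolding C_def by blast
    have "(s *\<^sub>R x + t *\<^sub>R z, s *\<^sub>R h1 + t *\<^sub>R g1) \<in> G1"
      using convexD[OF conv(1) c(2) d(2) st] by simp
    moreover have "(s *\<^sub>R x' + t *\<^sub>R z', s *\<^sub>R h2 + t *\<^sub>R g2) \<in> G2"
      using convexD[OF conv(2) c(3) d(3) st] by simp
    moreover have "s *\<^sub>R a + t *\<^sub>R b \<in> A" by (rule convexD[OF conv(3) c(4) d(4) st])
    moreover have "s *\<^sub>R c + t *\<^sub>R d =
      ((s *\<^sub>R x + t *\<^sub>R z) - (s *\<^sub>R x' + t *\<^sub>R z'),
       L (s *\<^sub>R x' + t *\<^sub>R z') - (s *\<^sub>R h1 + t *\<^sub>R g1) - (s *\<^sub>R h2 + t *\<^sub>R g2)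
         + (s *\<^sub>R a + t *\<^sub>R b) - y)"
    proof -
      have y: "s *\<^sub>R y + t *\<^sub>R y = y" using st(3) by (simp flip: scaleR_left_distrib)
      have "s *\<^sub>R (L x' - h1 - h2 + a - y) + t *\<^sub>R (L z' - g1 - g2 + b - y) =
        L (s *\<^sub>R x' + t *\<^sub>R z') - (s *\<^sub>R h1 + t *\<^sub>R g1) - (s *\<^sub>R h2 + t *\<^sub>R g2)
         + (s *\<^sub>R a + t *\<^sub>R b) - (s *\<^sub>R y + t *\<^sub>R y)"
        by (simp add: linear_add[OF linL] linear_scale[OF linL]
            scaleR_right_distrib scaleR_right_diff_distrib)
      then show ?thesis
        unfolding y by (simp add: c(1) d(1) scaleR_right_diff_distrib)
    qed
    ultimately show "s *\<^sub>R c + t *\<^sub>R d \<in> C" unfolding C_def by blast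
  qed
  define P where "P = {(0, k) - t *\<^sub>R c |k t c. k \<in> K \<and> t \<ge> 0 \<and> c \<in> C}"
  have PI: "(0, k) - t *\<^sub>R c \<in> P" if "k \<in> K" "t \<ge> 0" "c \<in> C" for k t c
    using that unfolding P_def by blast
  have c0: "(x0 - x0, L x0 - b1 - b2 + a0 - y) \<in> C"
    using x0 a0 W unfolding C_def by blast
  have "\<exists>f. linear f \<and> f (0, k0) = (1::real) \<and> (\<forall>p\<in>P. f p \<ge> 0)"
  proof (rule order_unit_separation)
    fix p q assume "p \<in> P" "q \<in> P"
    then obtain k t c k' t' c' where p: "p = (0, k) - t *\<^sub>R c" "k \<in> K" "t \<ge> 0" "c \<in> C"
      and q: "q = (0, k') - t' *\<^sub>R c'" "k' \<in> K" "t' \<ge> 0" "c' \<in> C" unfolding P_def by blast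
    show "p + q \<in> P"
    proof (cases "t + t' = 0")
      case True
      then have "t = 0" "t' = 0" using p q by auto
      then show ?thesis using PI[OF cone_add[OF p(2) q(2)] order_refl c0] p(1) q(1) by simp
    next
      case False
      \<comment> \<open>Convexity of C: the two subtracted multiples merge into one multiple of a point of C.\<close>
      define d where "d = (t / (t + t')) *\<^sub>R c + (t' / (t + t')) *\<^sub>R c'"
      have "d \<in> C"
        unfolding d_def using False p(3) q(3)
        by (intro convexD[OF convC p(4) q(4)]) (auto simp: add_divide_distrib[symmetric])
      moreover have "(t + t') *\<^sub>R d = t *\<^sub>R c + t' *\<^sub>R c'"
        using False by (simp add: d_def scaleR_right_distrib)
      then have "p + q = (0, k + k') - (t + t') *\<^sub>R d"
        using p(1) q(1) by simp
      ultimately show ?thesis using PI[OF cone_add[OF p(2) q(2)]] p(3) q(3) by simp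
    qed
  next
    fix s :: real and p assume s: "s > 0" "p \<in> P"
    then obtain k t c where p: "p = (0, k) - t *\<^sub>R c" "k \<in> K" "t \<ge> 0" "c \<in> C"
      unfolding P_def by blast
    have "s *\<^sub>R p = (0, s *\<^sub>R k) - (s * t) *\<^sub>R c" by (simp add: p(1) scaleR_right_diff_distrib)
    then show "s *\<^sub>R p \<in> P" using PI[OF cone_scale[OF p(2)] _ p(4)] s(1) p(3) by simp
  next
    fix p :: "'x \<times> 'y"
    obtain u v where p: "p = (u, v)" by (cases p)
    obtain r where r: "r > 0" "x0 + r *\<^sub>R u \<in> W"
      using open_lctvs_absorbs[OF W(1,2), of u] by auto
    \<comment> \<open>Moving x' from x0 by r u realises the first component - r u in C.\<close>
    define w where "w = L (x0 + r *\<^sub>R u) - b1 - b2 + a0 - y"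
    have c: "(- r *\<^sub>R u, w) \<in> C"
    proof -
      have "(x0 - (x0 + r *\<^sub>R u), w) \<in> C" using x0 a0 W(3)[OF r(2)] unfolding C_def w_def by blast
      then show ?thesis by simp
    qed
    obtain s where s: "(v + inverse r *\<^sub>R w) + s *\<^sub>R k0 \<in> interior K"
      using interior_cone_order_unit[OF k0] by blast
    have "p + s *\<^sub>R (0, k0) = (0, (v + inverse r *\<^sub>R w) + s *\<^sub>R k0) - inverse r *\<^sub>R (- r *\<^sub>R u, w)"
      using r(1) by (simp add: p)
    then have "p + s *\<^sub>R (0, k0) \<in> P"
      using PI[OF interior_subset_cone[OF s] _ c, of "inverse r"] r(1) by simp
    then show "\<exists>s. p + s *\<^sub>R (0, k0) \<in> P" by blast
  next
    show "0 \<in> P" using PI[OF zero_in_cone order_refl c0] by (simp add: zero_prod_def)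
  next
    show "- (0, k0) \<notin> P"
    proof
      assume "- (0, k0) \<in> P"
      then obtain k t c where p: "- (0, k0) = (0, k) - t *\<^sub>R c" "k \<in> K" "t \<ge> 0" "c \<in> C"
        unfolding P_def by blast
      obtain x h1 x' h2 a where c: "c = (x - x', L x' - h1 - h2 + a - y)"
        "(x, h1) \<in> G1" "(x', h2) \<in> G2" "a \<in> A" using p(4) unfolding C_def by blast
      let ?d = "L x' - h1 - h2 + a - y"
      have t1: "t *\<^sub>R (x - x') = 0" and t2: "t *\<^sub>R ?d = k0 + k"
        using p(1) by (auto simp: c(1) algebra_simps)
      have "t \<noteq> 0"
      proof
        assume "t = 0"
        then have "k = - k0" using t2 by (simp add: eq_neg_iff_add_eq_0 add.commute)
        then show False using p(2) neg_interior_notin_cone[OF k0] by simp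
      qed
      then have "x = x'" using t1 by simp
      \<comment> \<open>With equal first arguments, the second component of c would be an interior point of K.\<close>
      have "?d = inverse t *\<^sub>R (t *\<^sub>R ?d)" using \<open>t \<noteq> 0\<close> by simp
      also have "\<dots> \<in> interior K"
        unfolding t2 using \<open>t \<noteq> 0\<close> p(3) by (intro interior_cone_scale interior_cone_add k0 p(2)) auto
      finally show False using sep[OF _ c(3,4)] c(2) \<open>x = x'\<close> by blast
    qed
  qed
  then obtain f where f: "linear f" "f (0, k0) = (1::real)" "\<And>p. p \<in> P \<Longrightarrow> f p \<ge> 0" by blast
  have "f (0, k) \<ge> 0" if "k \<in> K" for k
    using f(3)[OF PI[OF that order_refl c0]] by simp
  moreover have "f c \<le> 0" if "c \<in> C" for c
  proof -
    have "f (- c) \<ge> 0" using f(3)[OF PI[OF zero_in_cone _ that, of 1]] by (simp flip: zero_prod_def)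
    then show ?thesis using linear_neg[OF f(1), of c] by simp
  qed
  moreover have "(x - x', L x' - h1 - h2 + a - y) \<in> C"
    if "(x, h1) \<in> G1" "(x', h2) \<in> G2" "a \<in> A" for x h1 x' h2 a
    using that unfolding C_def by blast
  ultimately show ?thesis
    using f(1,2) by (intro exI[of _ f]) blast
qed

definition positive_functional :: "('y \<Rightarrow> real) \<Rightarrow> bool" where
  "positive_functional f \<longleftrightarrow> linear f \<and> (\<forall>k\<in>interior K. f k > 0)"

text \<open>
  Splitting the separating functional as \<open>e u + f v\<close>, the rank-one map \<open>L1 x = e x k0\<close>
  satisfies \<open>f (L1 x) = e x\<close>. Thus the inequality on \<open>C\<close> becomes a sum of three
  independent expressions, each of which can be bounded on its own. Continuity of \<open>L1\<close> follows from
  the upper bound \<open>b2\<close> on \<open>W\<close>, which bounds \<open>- e\<close> from above near \<open>x0\<close>.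
\<close>

lemma vector_sandwich:
  fixes G1 G2 :: "('x::lctvs \<times> 'y) set" and L :: "'x \<Rightarrow> 'y"
  assumes conv: "convex G1" "convex G2" "convex A" and L: "L \<in> clin"
    and x0: "(x0, b1) \<in> G1" and a0: "a0 \<in> A"
    and W: "open W" "x0 \<in> W" "\<And>x. x \<in> W \<Longrightarrow> (x, b2) \<in> G2"
    and sep: "\<And>x h1 h2 a. (x, h1) \<in> G1 \<Longrightarrow> (x, h2) \<in> G2 \<Longrightarrow> a \<in> A \<Longrightarrow>
      L x - h1 - h2 + a - y \<notin> interior K"
  obtains f L1 L2 a1 a2 a3 where "positive_functional f" "L1 \<in> clin" "L2 \<in> clin"
    "L = (\<lambda>x. L1 x + L2 x)" "a1 + a2 + a3 = f y"
    "\<And>x h. (x, h) \<in> G1 \<Longrightarrow> f (L1 x - h) \<le> a1" "\<And>x h. (x, h) \<in> G2 \<Longrightarrow> f (L2 x - h) \<le> a2"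
    "\<And>a. a \<in> A \<Longrightarrow> f a \<le> a3"
proof -
  obtain k0 where k0: "k0 \<in> interior K" using K by (auto simp: ordering_cone_def)
  obtain g :: "'x \<times> 'y \<Rightarrow> real" where g: "linear g" "g (0, k0) = 1" "\<And>k. k \<in> K \<Longrightarrow> g (0, k) \<ge> 0"
    and gC: "\<And>x h1 x' h2 a. (x, h1) \<in> G1 \<Longrightarrow> (x', h2) \<in> G2 \<Longrightarrow> a \<in> A \<Longrightarrow>
      g (x - x', L x' - h1 - h2 + a - y) \<le> 0"
    using joint_separation[OF conv L k0 x0 a0 W sep] by fast
  define f where "f v = g (0, v)" for v
  define e where "e u = g (u, 0)" for u
  have f: "linear f"
  proof (rule linearI)
    show "f (a + b) = f a + f b" for a b
      using linear_add[OF g(1), of "(0, a)" "(0, b)"] by (simp add: f_def)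
    show "f (c *\<^sub>R a) = c *\<^sub>R f a" for c a
      using linear_scale[OF g(1), of c "(0, a)"] by (simp add: f_def)
  qed
  have e: "linear e"
  proof (rule linearI)
    show "e (a + b) = e a + e b" for a b
      using linear_add[OF g(1), of "(a, 0)" "(b, 0)"] by (simp add: e_def)
    show "e (c *\<^sub>R a) = c *\<^sub>R e a" for c a
      using linear_scale[OF g(1), of c "(a, 0)"] by (simp add: e_def)
  qed
  have split: "g (u, v) = e u + f v" for u v
    using linear_add[OF g(1), of "(u, 0)" "(0, v)"] by (simp add: e_def f_def)
  have fk0: "f k0 = 1" and fK: "\<And>k. k \<in> K \<Longrightarrow> f k \<ge> 0" using g by (auto simp: f_def)
  have pos: "positive_functional f"
    unfolding positive_functional_def
  proof (intro conjI ballI f)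
    fix k assume "k \<in> interior K"
    then obtain r where r: "r > 0" "k - r *\<^sub>R k0 \<in> interior K" using interior_cone_shrink by blast
    then have "f (k - r *\<^sub>R k0) \<ge> 0" using fK interior_subset_cone by blast
    then show "f k > 0" using r(1) fk0 by (simp add: linear_diff[OF f] linear_scale[OF f])
  qed
  have key: "(e x - f h1) + (f (L x') - e x' - f h2) + f a \<le> f y"
    if "(x, h1) \<in> G1" "(x', h2) \<in> G2" "a \<in> A" for x h1 x' h2 a
    using gC[OF that] by (simp add: split linear_diff[OF f] linear_add[OF f] linear_diff[OF e])
  have cont: "continuous_on UNIV e"
  proof -
    \<comment> \<open>On N both the bound b2 and the lower estimate f (L x) \<ge> f (L x0) - 1 are available.\<close>
    define N where "N = W \<inter> (\<lambda>x. L x + (k0 - L x0)) -` interior K"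
    have "open N"
      unfolding N_def using L
      by (intro open_Int W(1) open_vimage open_interior)
        (auto simp: clin_def continuous_on_def intro!: tendsto_add)
    moreover have "x0 \<in> N" using k0 W(2) by (simp add: N_def)
    moreover have "- e x \<le> f y - f a0 + f b2 + f b1 - e x0 - f (L x0 - k0)" if "x \<in> N" for x
    proof -
      have "f (L x + (k0 - L x0)) \<ge> 0" using that fK interior_subset_cone by (auto simp: N_def)
      moreover have "(e x0 - f b1) + (f (L x) - e x - f b2) + f a0 \<le> f y"
        using that by (intro key x0 a0 W(3)) (simp add: N_def)
      ultimately show ?thesis by (simp add: linear_diff[OF f] linear_add[OF f])
    qed
    ultimately have "continuous_on UNIV (\<lambda>x. - e x)"
      by (intro continuous_linear_functional[of _ N x0]) (auto intro: linear_compose_neg e)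
    from continuous_on_minus[OF this] show ?thesis by simp
  qed
  obtain a1 a2 a3 where
    a1: "\<And>s. s \<in> (\<lambda>(x, h). e x - f h) ` G1 \<Longrightarrow> s \<le> a1" and
    a2: "\<And>s. s \<in> (\<lambda>(x, h). f (L x) - e x - f h) ` G2 \<Longrightarrow> s \<le> a2" and
    a3: "\<And>s. s \<in> f ` A \<Longrightarrow> s \<le> a3" and sum: "a1 + a2 + a3 = f y"
  proof -
    have 1: "(\<lambda>(x, h). e x - f h) ` G1 \<noteq> {}" using x0 by blast
    have 2: "(\<lambda>(x, h). f (L x) - e x - f h) ` G2 \<noteq> {}" using W by blast
    have 3: "f ` A \<noteq> {}" using a0 by blast
    have 4: "s1 + s2 + s3 \<le> f y" if "s1 \<in> (\<lambda>(x, h). e x - f h) ` G1"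
      "s2 \<in> (\<lambda>(x, h). f (L x) - e x - f h) ` G2" "s3 \<in> f ` A" for s1 s2 s3
      using that key by fast
    show thesis using split_upper_bound[OF 1 2 3 4] that by blast
  qed
  define L1 where "L1 x = e x *\<^sub>R k0" for x
  have L1: "L1 \<in> clin" unfolding L1_def by (rule clin_rank_one[OF e cont])
  have fL1: "f (L1 x) = e x" for x by (simp add: L1_def linear_scale[OF f] fk0)
  show ?thesis
  proof (rule that[OF pos L1 clin_diff[OF L L1] _ sum])
    show "f (L1 x - h) \<le> a1" if "(x, h) \<in> G1" for x h
      using a1[of "e x - f h"] that by (force simp: linear_diff[OF f] fL1)
    show "f (L x - L1 x - h) \<le> a2" if "(x, h) \<in> G2" for x h
      using a2[of "f (L x) - e x - f h"] that by (force simp: linear_diff[OF f] fL1)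
  qed (use a3 in auto)
qed

end

section \<open>Epigraphs and local boundedness\<close>

lemma Fin_add_eq_Fin_iff:
  "a + b = Fin h \<longleftrightarrow> (\<exists>u v. a = Fin u \<and> b = Fin v \<and> h = u + v)"
  by (cases a; cases b) auto

lemma extended_add_eq_Minf_iff:
  "a + b = Minf \<longleftrightarrow> a \<noteq> Pinf \<and> b \<noteq> Pinf \<and> (a = Minf \<or> b = Minf)"
  by (cases a; cases b) auto

context ordered_lctvs
begin

definition epigraph :: "('x \<Rightarrow> 'y extended) \<Rightarrow> ('x \<times> 'y) set" where
  "epigraph H = {(x, y). \<exists>h. H x = Fin h \<and> y - h \<in> K}"

lemma epigraphI: "H x = Fin h \<Longrightarrow> y - h \<in> K \<Longrightarrow> (x, y) \<in> epigraph H"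
  by (simp add: epigraph_def)

lemma graph_in_epigraph: "H x = Fin h \<Longrightarrow> (x, h) \<in> epigraph H"
  by (simp add: epigraph_def zero_in_cone)

lemma convex_epigraph:
  fixes H :: "'x::lctvs \<Rightarrow> 'y extended"
  assumes "proper_ext H"
  shows "convex (epigraph H) \<longleftrightarrow> cone_convex K H"
proof -
  have "le_cone K (H x) (Fin y) \<longleftrightarrow> (\<exists>h. H x = Fin h \<and> y - h \<in> K)" for x y
  proof (cases "H x")
    case (Fin h)
    have "h - y \<in> uminus ` K \<longleftrightarrow> - (h - y) \<in> K" by (metis image_iff minus_minus)
    then show ?thesis using Fin by simp
  next
    case Minf
    then show ?thesis using assms unfolding proper_ext_def by (metis rangeI)
  qed simp
  then show ?thesis by (simp add: cone_convex_def epigraph_def)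
qed

text \<open>
  Fibrewise, the epigraph of a sum is the sum of the epigraphs.
\<close>

lemma convex_epigraph_add:
  fixes H1 H2 :: "'x::lctvs \<Rightarrow> 'y extended"
  assumes "convex (epigraph H1)" "convex (epigraph H2)"
  shows "convex (epigraph (\<lambda>x. H1 x + H2 x))"
proof -
  have split: "(x, y) \<in> epigraph (\<lambda>x. H1 x + H2 x) \<longleftrightarrow>
      (\<exists>y1 y2. (x, y1) \<in> epigraph H1 \<and> (x, y2) \<in> epigraph H2 \<and> y = y1 + y2)" for x y
  proof
    assume "(x, y) \<in> epigraph (\<lambda>x. H1 x + H2 x)"
    then obtain h1 h2 where h: "H1 x = Fin h1" "H2 x = Fin h2" "y - (h1 + h2) \<in> K"
      by (auto simp: epigraph_def Fin_add_eq_Fin_iff)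
    have "(y - h2) - h1 \<in> K" using h(3) by (simp add: algebra_simps)
    then have "(x, y - h2) \<in> epigraph H1" using epigraphI[of H1, OF h(1)] by blast
    then show "\<exists>y1 y2. (x, y1) \<in> epigraph H1 \<and> (x, y2) \<in> epigraph H2 \<and> y = y1 + y2"
      using graph_in_epigraph[of H2, OF h(2)] by (intro exI[of _ "y - h2"] exI[of _ h2]) simp
  next
    assume "\<exists>y1 y2. (x, y1) \<in> epigraph H1 \<and> (x, y2) \<in> epigraph H2 \<and> y = y1 + y2"
    then obtain y1 y2 h1 h2 where h: "H1 x = Fin h1" "H2 x = Fin h2" "y1 - h1 \<in> K" "y2 - h2 \<in> K"
      "y = y1 + y2" by (auto simp: epigraph_def)
    have "y - (h1 + h2) = (y1 - h1) + (y2 - h2)" using h(5) by simp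
    then have "y - (h1 + h2) \<in> K" using cone_add[OF h(3,4)] by argo
    then show "(x, y) \<in> epigraph (\<lambda>x. H1 x + H2 x)"
      using h(1,2) by (simp add: epigraph_def)
  qed
  show ?thesis
  proof (rule convexI)
    fix p q and s t :: real
    assume pq: "p \<in> epigraph (\<lambda>x. H1 x + H2 x)" "q \<in> epigraph (\<lambda>x. H1 x + H2 x)"
      and st: "0 \<le> s" "0 \<le> t" "s + t = 1"
    obtain x y where xy: "p = (x, y)" by (cases p)
    obtain y1 y2 where p: "p = (x, y1 + y2)" "(x, y1) \<in> epigraph H1" "(x, y2) \<in> epigraph H2"
      using pq(1) unfolding xy split by blast
    obtain z v where zv: "q = (z, v)" by (cases q)
    obtain v1 v2 where q: "q = (z, v1 + v2)" "(z, v1) \<in> epigraph H1" "(z, v2) \<in> epigraph H2"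
      using pq(2) unfolding zv split by blast
    have "(s *\<^sub>R x + t *\<^sub>R z, s *\<^sub>R y1 + t *\<^sub>R v1) \<in> epigraph H1"
      using convexD[OF assms(1) p(2) q(2) st] by simp
    moreover have "(s *\<^sub>R x + t *\<^sub>R z, s *\<^sub>R y2 + t *\<^sub>R v2) \<in> epigraph H2"
      using convexD[OF assms(2) p(3) q(3) st] by simp
    moreover have "s *\<^sub>R p + t *\<^sub>R q = (s *\<^sub>R x + t *\<^sub>R z,
        (s *\<^sub>R y1 + t *\<^sub>R v1) + (s *\<^sub>R y2 + t *\<^sub>R v2))"
      by (simp add: p(1) q(1) scaleR_right_distrib)
    ultimately show "s *\<^sub>R p + t *\<^sub>R q \<in> epigraph (\<lambda>x. H1 x + H2 x)"
      using split by metis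
  qed
qed

text \<open>
  What the separation needs of continuity at \<open>x\<close>: a common upper bound \<open>b\<close> on a neighbourhood.
  Such bounds add up under sums of mappings.
\<close>

definition locally_bounded_above :: "('x::lctvs \<Rightarrow> 'y extended) \<Rightarrow> 'x \<Rightarrow> bool" where
  "locally_bounded_above H x \<longleftrightarrow>
    (\<exists>b W. open W \<and> x \<in> W \<and> (\<forall>z\<in>W. (z, b) \<in> epigraph H))"

lemma continuous_locally_bounded_above:
  assumes "ext_continuous_at H x"
  shows "locally_bounded_above H x"
proof -
  obtain k0 where k0: "k0 \<in> interior K" using K by (auto simp: ordering_cone_def)
  obtain y where y: "H x = Fin y"
    "\<And>V. open V \<Longrightarrow> y \<in> V \<Longrightarrow> \<exists>U. open U \<and> x \<in> U \<and> H ` U \<subseteq> Fin ` V"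
    using assms unfolding ext_continuous_at_def by blast
  define V where "V = (\<lambda>v. (y + k0) + - v) -` interior K"
  have "open V" unfolding V_def
    by (intro open_vimage open_interior)
      (auto simp: continuous_on_def simp del: add_uminus_conv_diff intro!: tendsto_add tendsto_minus)
  moreover have "y \<in> V" using k0 by (simp add: V_def)
  ultimately obtain U where U: "open U" "x \<in> U" "H ` U \<subseteq> Fin ` V"
    using y(2)[of V] by blast
  have "(z, y + k0) \<in> epigraph H" if "z \<in> U" for z
  proof -
    have "H z \<in> Fin ` V" using U(3) that by blast
    then obtain v where v: "v \<in> V" "H z = Fin v" by blast
    then have "(y + k0) - v \<in> K" using interior_subset_cone by (simp add: V_def)
    then show ?thesis using v(2) by (simp add: epigraph_def)
  qed
  then show ?thesis using U unfolding locally_bounded_above_def by blast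
qed

lemma locally_bounded_above_add:
  assumes "locally_bounded_above H1 x" "locally_bounded_above H2 x"
  shows "locally_bounded_above (\<lambda>x. H1 x + H2 x) x"
proof -
  obtain b1 W1 b2 W2 where W: "open W1" "x \<in> W1" "open W2" "x \<in> W2"
    and b: "\<And>z. z \<in> W1 \<Longrightarrow> (z, b1) \<in> epigraph H1" "\<And>z. z \<in> W2 \<Longrightarrow> (z, b2) \<in> epigraph H2"
    using assms unfolding locally_bounded_above_def by blast
  have "(z, b1 + b2) \<in> epigraph (\<lambda>x. H1 x + H2 x)" if z: "z \<in> W1 \<inter> W2" for z
  proof -
    have "(z, b1) \<in> epigraph H1" "(z, b2) \<in> epigraph H2" using b z by auto
    then obtain h1 h2 where h: "H1 z = Fin h1" "H2 z = Fin h2" "b1 - h1 \<in> K" "b2 - h2 \<in> K"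
      by (auto simp: epigraph_def)
    have "(b1 + b2) - (h1 + h2) = (b1 - h1) + (b2 - h2)" by simp
    then have "(b1 + b2) - (h1 + h2) \<in> K" using cone_add[OF h(3,4)] by argo
    then show ?thesis using h(1,2) by (simp add: epigraph_def)
  qed
  then show ?thesis
    unfolding locally_bounded_above_def using W by (intro exI[of _ "b1 + b2"] exI[of _ "W1 \<inter> W2"]) auto
qed

lemma locally_bounded_above_dom: "locally_bounded_above H x \<Longrightarrow> x \<in> edom H"
  by (auto simp: locally_bounded_above_def epigraph_def edom_def)

lemma proper_dom_Fin:
  assumes "proper_ext H" "x \<in> edom H"
  obtains h where "H x = Fin h"
proof (cases "H x")
  case Minf
  then show ?thesis using assms(1) unfolding proper_ext_def by (metis rangeI)
qed (use assms(2) that in \<open>auto simp: edom_def\<close>)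

lemma proper_add:
  fixes H1 H2 :: "'x \<Rightarrow> 'y extended"
  assumes H: "proper_ext H1" "proper_ext H2" and x: "x \<in> edom H1" "x \<in> edom H2"
  shows "proper_ext (\<lambda>x. H1 x + H2 x)"
proof -
  have "H1 z + H2 z \<noteq> Minf" for z
    using H unfolding proper_ext_def by (metis extended_add_eq_Minf_iff rangeI)
  moreover obtain h1 where "H1 x = Fin h1" using proper_dom_Fin[OF H(1) x(1)] .
  moreover obtain h2 where "H2 x = Fin h2" using proper_dom_Fin[OF H(2) x(2)] .
  ultimately have "Minf \<notin> range (\<lambda>x. H1 x + H2 x)" "x \<in> edom (\<lambda>x. H1 x + H2 x)"
    by (auto simp: edom_def image_iff dest: sym)
  then show ?thesis unfolding proper_ext_def by blast
qed

section \<open>Conjugate epigraphs as avoidance of a down-set\<close>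

lemma conj_map_eq:
  fixes H :: "'x::lctvs \<Rightarrow> 'y extended" and L :: "'x \<Rightarrow> 'y"
  assumes "proper_ext H"
  defines "M \<equiv> range (\<lambda>x. Fin (L x) - H x)"
  shows "Pinf \<notin> M" "Fin m \<in> M \<longleftrightarrow> (\<exists>x h. H x = Fin h \<and> m = L x - h)" "\<exists>m. Fin m \<in> M"
proof -
  have val: "Fin (L x) - H x = v \<longleftrightarrow> (\<exists>h. H x = Fin h \<and> v = Fin (L x - h)) \<or> H x = Pinf \<and> v = Minf" for x v
  proof -
    have "H x \<noteq> Minf" using assms(1) unfolding proper_ext_def by (metis rangeI)
    then show ?thesis by (cases "H x") auto
  qed
  have "Fin (L x) - H x \<noteq> Pinf" for x unfolding val by simp
  then show "Pinf \<notin> M" unfolding M_def image_iff by metis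
  show Fin: "Fin m \<in> M \<longleftrightarrow> (\<exists>x h. H x = Fin h \<and> m = L x - h)" for m
  proof -
    have "Fin m \<in> M \<longleftrightarrow> (\<exists>x. Fin (L x) - H x = Fin m)" unfolding M_def image_iff by (metis UNIV_I)
    then show ?thesis unfolding val by auto
  qed
  obtain x h where "H x = Fin h"
    using assms(1) proper_dom_Fin[OF assms(1)] unfolding proper_ext_def by blast
  then show "\<exists>m. Fin m \<in> M" using Fin by blast
qed

lemma below_conj:
  fixes H :: "'x::lctvs \<Rightarrow> 'y extended"
  assumes "proper_ext H"
  shows "d \<in> below (range (\<lambda>x. Fin (L x) - H x)) \<longleftrightarrow>
    (\<exists>x h. H x = Fin h \<and> L x - h - d \<in> interior K)"
  by (auto simp: below_def conj_map_eq(2)[OF assms])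

text \<open>
  Adding \<open>K\<close> to the frontier of \<open>D(H, L)\<close> gives precisely the complement of \<open>D(H, L)\<close>. If
  \<open>D(H, L)\<close> is the whole space, both sides are false, as \<open>\<infinity> + k\<close> is never finite.
\<close>

lemma epi_conj_iff:
  fixes H :: "'x::lctvs \<Rightarrow> 'y extended"
  assumes H: "proper_ext H"
  shows "(L, y) \<in> epi_conj K H \<longleftrightarrow>
    L \<in> clin \<and> (\<forall>x h. H x = Fin h \<longrightarrow> L x - h - y \<notin> interior K)"
proof -
  define M where "M = range (\<lambda>x. Fin (L x) - H x)"
  note M = conj_map_eq[OF H, where L = L, folded M_def]
  obtain m where m: "Fin m \<in> M" using M(3) by blast
  have "Fin y \<in> conj_map K H L + Fin ` K \<longleftrightarrow> (\<exists>w. Fin w \<in> WSup K M \<and> y - w \<in> K)"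
  proof
    assume "Fin y \<in> conj_map K H L + Fin ` K"
    then obtain c k where c: "c \<in> WSup K M" "k \<in> K" "Fin y = c + Fin k"
      unfolding conj_map_def M_def set_plus_def by blast
    then show "\<exists>w. Fin w \<in> WSup K M \<and> y - w \<in> K" by (cases c) auto
  next
    assume "\<exists>w. Fin w \<in> WSup K M \<and> y - w \<in> K"
    then obtain w where w: "Fin w \<in> WSup K M" "y - w \<in> K" by blast
    have "Fin y = Fin w + Fin (y - w)" by simp
    then show "Fin y \<in> conj_map K H L + Fin ` K"
      using w unfolding conj_map_def M_def set_plus_def by blast
  qed
  also have "\<dots> \<longleftrightarrow> (\<exists>w\<in>frontier_below M. y - w \<in> K)"
    using WSup_Fin_iff[OF M(1) m] by blast
  also have "\<dots> \<longleftrightarrow> y \<notin> below M" using above_frontier_iff[OF m] by simp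
  finally show ?thesis using below_conj[OF H, where L = L, folded M_def] by (auto simp: epi_conj_def)
qed

lemma PpE:
  assumes "U \<in> Pp K"
  obtains V where "U = Fin ` V" "V \<noteq> {}"
    "\<And>y. y \<in> V \<or> (\<exists>u\<in>V. u - y \<in> interior K) \<or> (\<exists>u\<in>V. y - u \<in> interior K)"
proof -
  obtain V where V: "U = Fin ` V" "(V + uminus ` interior K) \<union> V \<union> (V + interior K) = UNIV"
    using assms unfolding Pp_def by blast
  have 1: "y \<in> V + interior K \<longleftrightarrow> (\<exists>u\<in>V. y - u \<in> interior K)" for y
    by (force simp: set_plus_def)
  have 2: "y \<in> V + uminus ` interior K \<longleftrightarrow> (\<exists>u\<in>V. u - y \<in> interior K)" for y
  proof
    assume "y \<in> V + uminus ` interior K"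
    then show "\<exists>u\<in>V. u - y \<in> interior K" by (force simp: set_plus_def)
  next
    assume "\<exists>u\<in>V. u - y \<in> interior K"
    then obtain u where "u \<in> V" "u - y \<in> interior K" by blast
    moreover have "y = u + - (u - y)" by simp
    ultimately show "y \<in> V + uminus ` interior K" unfolding set_plus_def by blast
  qed
  have "V \<noteq> {}" using V(2) by (auto simp: set_plus_def)
  moreover have "y \<in> V \<or> (\<exists>u\<in>V. u - y \<in> interior K) \<or> (\<exists>u\<in>V. y - u \<in> interior K)" for y
    using V(2) 1 2 by blast
  ultimately show ?thesis using that V(1) by blast
qed

lemma Pp_dominates:
  assumes U: "U \<in> Pp K" and z: "\<And>u. Fin u \<in> U \<Longrightarrow> z - u \<notin> interior K"
  shows "\<exists>u. Fin u \<in> U \<and> u - z \<in> K"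
proof -
  obtain V where V: "U = Fin ` V"
    "\<And>y. y \<in> V \<or> (\<exists>u\<in>V. u - y \<in> interior K) \<or> (\<exists>u\<in>V. y - u \<in> interior K)"
    using PpE[OF U] by metis
  have "z \<in> V \<or> (\<exists>u\<in>V. u - z \<in> interior K)" using V(2)[of z] z V(1) by blast
  then show ?thesis using V(1) interior_subset_cone zero_in_cone by (metis diff_self imageI)
qed

text \<open>
  A point of \<open>U\<close> strictly below a frontier point of \<open>D(H, L)\<close> lies in \<open>D(H, L)\<close>, and conversely
  every point of \<open>D(H, L)\<close> is strictly below a frontier point. If \<open>U\<close> misses \<open>D(H, L)\<close>, then
  \<open>D(H, L)\<close> is proper, so the domain condition on \<open>L\<close> is automatic.
\<close>

lemma Epi_conj_iff:
  fixes H :: "'x::lctvs \<Rightarrow> 'y extended"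
  assumes H: "proper_ext H"
  shows "(L, U) \<in> Epi_conj K H \<longleftrightarrow> U \<in> Pp K \<and> L \<in> clin \<and>
    (\<forall>u x h. Fin u \<in> U \<longrightarrow> H x = Fin h \<longrightarrow> L x - h - u \<notin> interior K)"
proof (cases "U \<in> Pp K \<and> L \<in> clin")
  case True
  then obtain V where V: "U = Fin ` V" "V \<noteq> {}" using PpE by metis
  define M where "M = range (\<lambda>x. Fin (L x) - H x)"
  note M = conj_map_eq[OF H, where L = L, folded M_def]
  obtain m where m: "Fin m \<in> M" using M(3) by blast
  have "WSup K M \<noteq> {Pinf} \<and> set_prec K (WSup K M) U \<longleftrightarrow> (\<forall>u\<in>V. u \<notin> below M)"
  proof
    assume *: "WSup K M \<noteq> {Pinf} \<and> set_prec K (WSup K M) U"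
    then obtain z where z: "z \<notin> below M" using WSup_eq_Pinf[OF M(1) m] by blast
    show "\<forall>u\<in>V. u \<notin> below M"
    proof (intro ballI notI)
      fix u assume u: "u \<in> V" "u \<in> below M"
      obtain w where w: "w \<in> frontier_below M" "w - u \<in> interior K"
        using below_frontier[OF m z u(2)] by blast
      then have "Fin w \<in> WSup K M" using WSup_Fin_iff[OF M(1) m] by blast
      then have "\<not> less_cone K (Fin u) (Fin w)" using * u(1) V(1) unfolding set_prec_def by blast
      then show False using w(2) by simp
    qed
  next
    assume *: "\<forall>u\<in>V. u \<notin> below M"
    have prec: "\<not> less_cone K (Fin u) w" if w: "w \<in> WSup K M" and u: "u \<in> V" for w u
    proof
      assume "less_cone K (Fin u) w"
      then obtain v where v: "v \<in> M" "less_cone K (Fin u) v" using w unfolding WSup_def by blast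
      then obtain a where "v = Fin a" using M(1) by (cases v) auto
      then have "u \<in> below M" using v belowI by simp
      then show False using * u by blast
    qed
    moreover have "WSup K M \<noteq> {Pinf}" using prec[of Pinf] V(2) by fastforce
    ultimately show "WSup K M \<noteq> {Pinf} \<and> set_prec K (WSup K M) U"
      unfolding set_prec_def V(1) by blast
  qed
  moreover have "conj_map K H L = WSup K M" by (simp add: conj_map_def M_def)
  ultimately have "(L, U) \<in> Epi_conj K H \<longleftrightarrow> (\<forall>u\<in>V. u \<notin> below M)"
    using True by (simp add: Epi_conj_def conj_dom_def)
  also have "\<dots> \<longleftrightarrow> (\<forall>u x h. Fin u \<in> U \<longrightarrow> H x = Fin h \<longrightarrow> L x - h - u \<notin> interior K)"
    using below_conj[OF H, where L = L, folded M_def] V(1) by auto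
  finally show ?thesis using True by blast
qed (auto simp: Epi_conj_def conj_dom_def)

lemma Psi_Epi_conj_subset:
  assumes "proper_ext H"
  shows "Psi (Epi_conj K H) \<subseteq> epi_conj K H"
proof
  fix p assume "p \<in> Psi (Epi_conj K H)"
  then obtain L U y where p: "p = (L, y)" "Fin y \<in> U" "(L, U) \<in> Epi_conj K H"
    unfolding Psi_def by blast
  then show "p \<in> epi_conj K H"
    unfolding p(1) Epi_conj_iff[OF assms] epi_conj_iff[OF assms] by blast
qed


text \<open>
  Each of the two values is dominated by a point of its surface, so their sum is dominated by a
  point of \<open>U1 + U2\<close>, and no point of the weak supremum is strictly below such a point. The base
  points \<open>x\<close> and \<open>x'\<close> are independent, which is what the comparison of triple sums needs.
\<close>

lemma ws_sum_Epi_conj_not_below: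
  fixes H1 H2 :: "'x::lctvs \<Rightarrow> 'y extended"
  assumes H: "proper_ext H1" "proper_ext H2"
    and LU: "(L1, U1) \<in> Epi_conj K H1" "(L2, U2) \<in> Epi_conj K H2"
    and y: "Fin y \<in> ws_sum K U1 U2" and x: "H1 x = Fin h" "H2 x' = Fin h'"
  shows "(L1 x - h) + (L2 x' - h') - y \<notin> interior K"
proof
  assume int: "(L1 x - h) + (L2 x' - h') - y \<in> interior K"
  have "\<exists>u. Fin u \<in> U1 \<and> u - (L1 x - h) \<in> K"
    using LU(1) x(1) unfolding Epi_conj_iff[OF H(1)] by (intro Pp_dominates) auto
  then obtain u1 where u1: "Fin u1 \<in> U1" "u1 - (L1 x - h) \<in> K" by blast
  have "\<exists>u. Fin u \<in> U2 \<and> u - (L2 x' - h') \<in> K"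
    using LU(2) x(2) unfolding Epi_conj_iff[OF H(2)] by (intro Pp_dominates) auto
  then obtain u2 where u2: "Fin u2 \<in> U2" "u2 - (L2 x' - h') \<in> K" by blast
  have "(u1 + u2) - y = ((L1 x - h) + (L2 x' - h') - y) + ((u1 - (L1 x - h)) + (u2 - (L2 x' - h')))"
    by simp
  then have "(u1 + u2) - y \<in> interior K" using interior_cone_add[OF int cone_add[OF u1(2) u2(2)]] by argo
  then have "less_cone K (Fin y) (Fin u1 + Fin u2)" by simp
  moreover have "Fin u1 + Fin u2 \<in> U1 + U2" using u1(1) u2(1) by blast
  ultimately show False using y unfolding ws_sum_def WSup_def by blast
qed

lemma boxplus_Epi_conj_subset:
  fixes H1 H2 :: "'x::lctvs \<Rightarrow> 'y extended"
  assumes "proper_ext H1" "proper_ext H2" "proper_ext (\<lambda>x. H1 x + H2 x)"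
  shows "boxplus K (Epi_conj K H1) (Epi_conj K H2) \<subseteq> Epi_conj K (\<lambda>x. H1 x + H2 x)"
proof
  fix p assume "p \<in> boxplus K (Epi_conj K H1) (Epi_conj K H2)"
  then obtain L1 U1 L2 U2 where p: "p = (\<lambda>x. L1 x + L2 x, ws_sum K U1 U2)"
    and LU: "(L1, U1) \<in> Epi_conj K H1" "(L2, U2) \<in> Epi_conj K H2" "ws_sum K U1 U2 \<in> Pp K"
    unfolding boxplus_def by blast
  have "L1 x + L2 x - h - y \<notin> interior K"
    if y: "Fin y \<in> ws_sum K U1 U2" and h: "H1 x + H2 x = Fin h" for y x h
  proof -
    obtain h1 h2 where h12: "H1 x = Fin h1" "H2 x = Fin h2" "h = h1 + h2"
      using h by (auto simp: Fin_add_eq_Fin_iff)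
    have "(L1 x - h1) + (L2 x - h2) - y = L1 x + L2 x - h - y" using h12(3) by simp
    then show ?thesis
      using ws_sum_Epi_conj_not_below[OF assms(1,2) LU(1,2) y h12(1,2)] by argo
  qed
  moreover have "(\<lambda>x. L1 x + L2 x) \<in> clin"
    using LU unfolding Epi_conj_iff[OF assms(1)] Epi_conj_iff[OF assms(2)] by (intro clin_add) auto
  ultimately show "p \<in> Epi_conj K (\<lambda>x. H1 x + H2 x)"
    unfolding p Epi_conj_iff[OF assms(3)] using LU(3) by blast
qed

section \<open>Hyperplanes as elements of the surface space\<close>

text \<open>
  A level set of a positive functional is the simplest surface in the space \<open>Pp K\<close>; its open sides
  are the two half-spaces, and weak suprema of sums of parallel level sets can be computed by adding
  heights.
\<close>

definition hyperplane :: "('y \<Rightarrow> real) \<Rightarrow> real \<Rightarrow> 'y extended set" where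
  "hyperplane f a = Fin ` {v. f v = a}"

lemma positive_functional_normalized:
  assumes f: "positive_functional f"
  obtains k0 where "k0 \<in> interior K" "f k0 = 1"
proof -
  obtain k where k: "k \<in> interior K" using K by (auto simp: ordering_cone_def)
  then have "f k > 0" using f by (simp add: positive_functional_def)
  then show ?thesis
    using that[of "inverse (f k) *\<^sub>R k"] interior_cone_scale[OF k, of "inverse (f k)"] f
    by (simp add: positive_functional_def linear_scale)
qed

lemma below_hyperplane:
  assumes f: "positive_functional f"
  shows "d \<in> below (hyperplane f a) \<longleftrightarrow> f d < a"
proof
  assume "d \<in> below (hyperplane f a)"
  then obtain m where "f m = a" "m - d \<in> interior K" by (auto simp: below_def hyperplane_def)
  then show "f d < a" using f by (force simp: positive_functional_def linear_diff)
next
  assume less: "f d < a"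
  obtain k0 where k0: "k0 \<in> interior K" "f k0 = 1" using positive_functional_normalized[OF f] .
  show "d \<in> below (hyperplane f a)"
  proof (rule belowI)
    show "Fin (d + (a - f d) *\<^sub>R k0) \<in> hyperplane f a"
      using f k0 by (simp add: hyperplane_def positive_functional_def linear_add linear_scale)
    show "d + (a - f d) *\<^sub>R k0 - d \<in> interior K"
      using interior_cone_scale[OF k0(1)] less by simp
  qed
qed

lemma WSup_hyperplane:
  assumes f: "positive_functional f"
  shows "WSup K (hyperplane f a) = hyperplane f a"
proof -
  have lin: "linear f" and pos: "\<And>k. k \<in> interior K \<Longrightarrow> f k > 0"
    using f by (auto simp: positive_functional_def)
  obtain k0 where k0: "k0 \<in> interior K" "f k0 = 1" using positive_functional_normalized[OF f] .
  have P: "Pinf \<notin> hyperplane f a" and m: "Fin (a *\<^sub>R k0) \<in> hyperplane f a"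
    using k0 by (auto simp: hyperplane_def linear_scale[OF lin])
  have front: "w \<in> frontier_below (hyperplane f a) \<longleftrightarrow> f w = a" for w
  proof
    assume w: "w \<in> frontier_below (hyperplane f a)"
    have "f w \<le> a + e" if "e > 0" for e
    proof -
      have "w - e *\<^sub>R k0 \<in> below (hyperplane f a)"
        using w interior_cone_scale[OF k0(1) that] by (simp add: frontier_below_def)
      then show ?thesis using k0 by (simp add: below_hyperplane[OF f] linear_diff[OF lin] linear_scale[OF lin])
    qed
    then have "f w \<le> a" by (rule field_le_epsilon)
    moreover have "\<not> f w < a" using w by (simp add: frontier_below_def below_hyperplane[OF f])
    ultimately show "f w = a" by simp
  next
    assume "f w = a"
    then show "w \<in> frontier_below (hyperplane f a)"
      using pos by (simp add: frontier_below_def below_hyperplane[OF f] linear_diff[OF lin])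
  qed
  have Fin: "Fin w \<in> WSup K (hyperplane f a) \<longleftrightarrow> f w = a" for w
    using WSup_Fin_iff[OF P m] front by simp
  have "Pinf \<notin> WSup K (hyperplane f a)"
  proof
    assume "Pinf \<in> WSup K (hyperplane f a)"
    then obtain v where "v \<in> hyperplane f a" "less_cone K (Fin (a *\<^sub>R k0)) v"
      unfolding WSup_def using less_cone.simps(3) by blast
    then obtain u where "f u = a" "u - a *\<^sub>R k0 \<in> interior K" by (auto simp: hyperplane_def)
    then show False using pos[of "u - a *\<^sub>R k0"] k0 by (simp add: linear_diff[OF lin] linear_scale[OF lin])
  qed
  moreover have "Minf \<notin> WSup K (hyperplane f a)"
    using m less_cone.simps(2) unfolding WSup_def by blast
  ultimately have "v \<in> WSup K (hyperplane f a) \<longleftrightarrow> v \<in> hyperplane f a" for v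
    using Fin by (cases v) (auto simp: hyperplane_def)
  then show ?thesis by blast
qed

lemma hyperplane_add:
  assumes f: "positive_functional f"
  shows "hyperplane f a + hyperplane f b = hyperplane f (a + b)"
proof
  show "hyperplane f a + hyperplane f b \<subseteq> hyperplane f (a + b)"
    using f by (auto simp: set_plus_def hyperplane_def positive_functional_def linear_add)
  show "hyperplane f (a + b) \<subseteq> hyperplane f a + hyperplane f b"
  proof
    fix w assume "w \<in> hyperplane f (a + b)"
    then obtain v where v: "w = Fin v" "f v = a + b" by (auto simp: hyperplane_def)
    obtain k0 where k0: "f k0 = 1" using positive_functional_normalized[OF f] by metis
    have "w = Fin (a *\<^sub>R k0) + Fin (v - a *\<^sub>R k0)" by (simp add: v(1))
    moreover have "Fin (a *\<^sub>R k0) \<in> hyperplane f a" "Fin (v - a *\<^sub>R k0) \<in> hyperplane f b"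
      using f k0 v(2) by (auto simp: hyperplane_def positive_functional_def linear_scale linear_diff)
    ultimately show "w \<in> hyperplane f a + hyperplane f b" unfolding set_plus_def by blast
  qed
qed

lemma ws_sum_hyperplane:
  "positive_functional f \<Longrightarrow> ws_sum K (hyperplane f a) (hyperplane f b) = hyperplane f (a + b)"
  by (simp add: ws_sum_def hyperplane_add WSup_hyperplane)

lemma hyperplane_in_Pp:
  assumes f: "positive_functional f"
  shows "hyperplane f a \<in> Pp K"
proof -
  have lin: "linear f" and pos: "\<And>k. k \<in> interior K \<Longrightarrow> f k > 0"
    using f by (auto simp: positive_functional_def)
  obtain k0 where k0: "k0 \<in> interior K" "f k0 = 1" using positive_functional_normalized[OF f] .
  define U where "U = {v. f v = a}"
  have up: "U + interior K = {v. f v > a}"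
  proof
    show "U + interior K \<subseteq> {v. f v > a}"
      using pos by (auto simp: U_def set_plus_def linear_add[OF lin])
    show "{v. f v > a} \<subseteq> U + interior K"
    proof
      fix v assume "v \<in> {v. f v > a}"
      then have "(f v - a) *\<^sub>R k0 \<in> interior K" using interior_cone_scale[OF k0(1)] by simp
      moreover have "v - (f v - a) *\<^sub>R k0 \<in> U"
        using k0 by (simp add: U_def linear_diff[OF lin] linear_scale[OF lin])
      moreover have "v = (v - (f v - a) *\<^sub>R k0) + (f v - a) *\<^sub>R k0" by simp
      ultimately show "v \<in> U + interior K" unfolding set_plus_def by blast
    qed
  qed
  have down: "U + uminus ` interior K = {v. f v < a}"
  proof
    show "U + uminus ` interior K \<subseteq> {v. f v < a}"
      using pos by (auto simp: U_def set_plus_def linear_diff[OF lin])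
    show "{v. f v < a} \<subseteq> U + uminus ` interior K"
    proof
      fix v assume "v \<in> {v. f v < a}"
      then have "(a - f v) *\<^sub>R k0 \<in> interior K" using interior_cone_scale[OF k0(1)] by simp
      moreover have "v + (a - f v) *\<^sub>R k0 \<in> U"
        using k0 by (simp add: U_def linear_add[OF lin] linear_scale[OF lin])
      moreover have "v = (v + (a - f v) *\<^sub>R k0) + - ((a - f v) *\<^sub>R k0)" by simp
      ultimately show "v \<in> U + uminus ` interior K" unfolding set_plus_def by blast
    qed
  qed
  show ?thesis
    unfolding Pp_def mem_Collect_eq
    by (intro exI[of _ U] conjI) (auto simp: up down hyperplane_def, auto simp: U_def)
qed

lemma hyperplane_in_Epi_conj:
  fixes H :: "'x::lctvs \<Rightarrow> 'y extended"
  assumes H: "proper_ext H" and f: "positive_functional f" and L: "L \<in> clin"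
    and le: "\<And>x h. H x = Fin h \<Longrightarrow> f (L x - h) \<le> a"
  shows "(L, hyperplane f a) \<in> Epi_conj K H"
  unfolding Epi_conj_iff[OF H]
proof (intro conjI allI impI notI hyperplane_in_Pp f L)
  fix u x h
  assume u: "Fin u \<in> hyperplane f a" and h: "H x = Fin h" and "L x - h - u \<in> interior K"
  then have "f (L x - h - u) > 0" using f by (simp add: positive_functional_def)
  then have "f (L x - h) > a"
    using f u by (auto simp: positive_functional_def linear_diff hyperplane_def)
  then show False using le[OF h] by simp
qed

lemma hyperplane_Epi_conj_mono:
  fixes H :: "'x::lctvs \<Rightarrow> 'y extended"
  assumes H: "proper_ext H" and f: "positive_functional f"
    and L: "(L, hyperplane f a) \<in> Epi_conj K H" and "a \<le> b"
  shows "(L, hyperplane f b) \<in> Epi_conj K H"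
  unfolding Epi_conj_iff[OF H]
proof (intro conjI allI impI notI hyperplane_in_Pp f)
  show "L \<in> clin" using L by (simp add: Epi_conj_iff[OF H])
  fix u x h
  assume u: "Fin u \<in> hyperplane f b" and h: "H x = Fin h" and int: "L x - h - u \<in> interior K"
  obtain k0 where k0: "k0 \<in> interior K" "f k0 = 1" using positive_functional_normalized[OF f] .
  have "Fin (u - (b - a) *\<^sub>R k0) \<in> hyperplane f a"
    using u f k0(2) by (auto simp: hyperplane_def positive_functional_def linear_diff linear_scale)
  then have "L x - h - (u - (b - a) *\<^sub>R k0) \<notin> interior K"
    using L h unfolding Epi_conj_iff[OF H] by blast
  moreover have "(b - a) *\<^sub>R k0 \<in> K"
    using \<open>a \<le> b\<close> k0(1) cone_scale interior_subset_cone by simp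
  moreover have "L x - h - (u - (b - a) *\<^sub>R k0) = (L x - h - u) + (b - a) *\<^sub>R k0" by simp
  ultimately show False using interior_cone_add[OF int] by metis
qed

lemma boxplus_hyperplaneI:
  assumes f: "positive_functional f" and "(L1, hyperplane f a) \<in> M1" "(L2, hyperplane f b) \<in> M2"
  shows "(\<lambda>x. L1 x + L2 x, hyperplane f (a + b)) \<in> boxplus K M1 M2"
proof -
  have "hyperplane f (a + b) = ws_sum K (hyperplane f a) (hyperplane f b)"
    by (simp add: ws_sum_hyperplane[OF f])
  moreover have "ws_sum K (hyperplane f a) (hyperplane f b) \<in> Pp K"
    by (simp add: ws_sum_hyperplane[OF f] hyperplane_in_Pp[OF f])
  ultimately show ?thesis using assms(2,3) unfolding boxplus_def by blast
qed

section \<open>Epigraphs of conjugates of sums\<close>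

text \<open>
  The sandwich theorem in terms of extended epigraphs. The set \<open>A\<close> is a parameter so that one
  statement serves both the two-term formula and the comparison of triple sums.
\<close>

lemma conjugate_sum_splitting:
  fixes H1 H2 :: "'x::lctvs \<Rightarrow> 'y extended"
  assumes H: "proper_ext H1" "proper_ext H2"
    and conv: "convex (epigraph H1)" "convex (epigraph H2)" "convex A" "A \<noteq> {}"
    and x0: "x0 \<in> edom H1" "locally_bounded_above H2 x0" and L: "L \<in> clin"
    and sep: "\<And>x h a. H1 x + H2 x = Fin h \<Longrightarrow> a \<in> A \<Longrightarrow> (L x - h) + a - y \<notin> interior K"
  obtains f L1 L2 a1 a2 a3 where "positive_functional f" "L = (\<lambda>x. L1 x + L2 x)"
    "(L1, hyperplane f a1) \<in> Epi_conj K H1" "(L2, hyperplane f a2) \<in> Epi_conj K H2"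
    "\<And>a. a \<in> A \<Longrightarrow> f a \<le> a3" "a1 + a2 + a3 = f y"
proof -
  obtain b1 where b1: "H1 x0 = Fin b1" using proper_dom_Fin[OF H(1) x0(1)] .
  obtain b2 W where W: "open W" "x0 \<in> W" "\<And>x. x \<in> W \<Longrightarrow> (x, b2) \<in> epigraph H2"
    using x0(2) unfolding locally_bounded_above_def by blast
  obtain a0 where a0: "a0 \<in> A" using conv(4) by blast
  have sep': "L x - h1 - h2 + a - y \<notin> interior K"
    if x: "(x, h1) \<in> epigraph H1" "(x, h2) \<in> epigraph H2" and a: "a \<in> A" for x h1 h2 a
  proof
    assume int: "L x - h1 - h2 + a - y \<in> interior K"
    obtain g1 g2 where g: "H1 x = Fin g1" "H2 x = Fin g2" "h1 - g1 \<in> K" "h2 - g2 \<in> K"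
      using x by (auto simp: epigraph_def)
    have "(L x - (g1 + g2)) + a - y = (L x - h1 - h2 + a - y) + ((h1 - g1) + (h2 - g2))" by simp
    then have "(L x - (g1 + g2)) + a - y \<in> interior K"
      using interior_cone_add[OF int cone_add[OF g(3,4)]] by argo
    then show False using sep[of x "g1 + g2" a] g(1,2) a by simp
  qed
  obtain f L1 L2 a1 a2 a3 where f: "positive_functional f" "L1 \<in> clin" "L2 \<in> clin"
    "L = (\<lambda>x. L1 x + L2 x)" "a1 + a2 + a3 = f y"
    and 1: "\<And>x h. (x, h) \<in> epigraph H1 \<Longrightarrow> f (L1 x - h) \<le> a1"
    and 2: "\<And>x h. (x, h) \<in> epigraph H2 \<Longrightarrow> f (L2 x - h) \<le> a2"
    and 3: "\<And>a. a \<in> A \<Longrightarrow> f a \<le> a3"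
    using vector_sandwich[OF conv(1-3) L graph_in_epigraph[of H1, OF b1] a0 W sep'] by blast
  have "(L1, hyperplane f a1) \<in> Epi_conj K H1"
    using 1 graph_in_epigraph[of H1] by (intro hyperplane_in_Epi_conj[OF H(1) f(1,2)]) blast
  moreover have "(L2, hyperplane f a2) \<in> Epi_conj K H2"
    using 2 graph_in_epigraph[of H2] by (intro hyperplane_in_Epi_conj[OF H(2) f(1,3)]) blast
  ultimately show ?thesis using that[OF f(1,4) _ _ 3 f(5)] by blast
qed

text \<open>
  For \<open>A = {0}\<close> the splitting produces two parallel hyperplanes whose sum passes through \<open>y\<close>.
\<close>

lemma epi_conj_add:
  fixes H1 H2 :: "'x::lctvs \<Rightarrow> 'y extended"
  assumes H: "proper_ext H1" "proper_ext H2"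
    and conv: "convex (epigraph H1)" "convex (epigraph H2)"
    and x0: "x0 \<in> edom H1" "locally_bounded_above H2 x0"
  shows "epi_conj K (\<lambda>x. H1 x + H2 x) = Psi (boxplus K (Epi_conj K H1) (Epi_conj K H2))"
proof
  have H12: "proper_ext (\<lambda>x. H1 x + H2 x)"
    using proper_add[OF H x0(1) locally_bounded_above_dom[OF x0(2)]] .
  show "Psi (boxplus K (Epi_conj K H1) (Epi_conj K H2)) \<subseteq> epi_conj K (\<lambda>x. H1 x + H2 x)"
    using boxplus_Epi_conj_subset[OF H H12] Psi_Epi_conj_subset[OF H12] unfolding Psi_def by blast
  show "epi_conj K (\<lambda>x. H1 x + H2 x) \<subseteq> Psi (boxplus K (Epi_conj K H1) (Epi_conj K H2))"
  proof
    fix p assume p: "p \<in> epi_conj K (\<lambda>x. H1 x + H2 x)"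
    obtain L y where Ly: "p = (L, y)" by (cases p)
    have L: "L \<in> clin" and
      sep: "\<And>x h. H1 x + H2 x = Fin h \<Longrightarrow> L x - h - y \<notin> interior K"
      using p unfolding Ly epi_conj_iff[OF H12] by auto
    have sep0: "(L x - h) + a - y \<notin> interior K" if "H1 x + H2 x = Fin h" "a \<in> {0}" for x h a
      using sep that by simp
    obtain f L1 L2 a1 a2 a3 where f: "positive_functional f" "L = (\<lambda>x. L1 x + L2 x)"
      "(L1, hyperplane f a1) \<in> Epi_conj K H1" "(L2, hyperplane f a2) \<in> Epi_conj K H2"
      and a3: "\<And>a. a \<in> {0} \<Longrightarrow> f a \<le> a3" and sum: "a1 + a2 + a3 = f y"
      using conjugate_sum_splitting[OF H conv convex_singleton insert_not_empty x0 L sep0] by blast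
    \<comment> \<open>The slack a3 is absorbed by raising the second hyperplane.\<close>
    have "a3 \<ge> 0" using a3[of 0] f(1) by (simp add: positive_functional_def linear_0)
    then have "(L2, hyperplane f (a2 + a3)) \<in> Epi_conj K H2"
      using hyperplane_Epi_conj_mono[OF H(2) f(1,4)] by simp
    then have "(L, hyperplane f (a1 + (a2 + a3))) \<in> boxplus K (Epi_conj K H1) (Epi_conj K H2)"
      unfolding f(2) by (rule boxplus_hyperplaneI[OF f(1,3)])
    moreover have "Fin y \<in> hyperplane f (a1 + (a2 + a3))" using sum by (simp add: hyperplane_def)
    ultimately show "p \<in> Psi (boxplus K (Epi_conj K H1) (Epi_conj K H2))"
      unfolding Ly Psi_def by blast
  qed
qed

text \<open>
  The surfaces \<open>U\<close>, \<open>U3\<close> behind a point \<open>y\<close> of the left-hand side are discarded: only the fact that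
  \<open>y\<close> is not strictly below a sum of values is kept. The splitting with \<open>A\<close> the set of all
  \<open>L3 x - h\<close>, \<open>(x, h)\<close> in the epigraph of \<open>H3\<close>, then yields three parallel hyperplanes through which \<open>y\<close> can be reached.
\<close>

lemma Psi_boxplus_add:
  fixes H1 H2 H3 :: "'x::lctvs \<Rightarrow> 'y extended"
  assumes H: "proper_ext H1" "proper_ext H2" "proper_ext H3"
    and conv: "convex (epigraph H1)" "convex (epigraph H2)" "convex (epigraph H3)"
    and x0: "x0 \<in> edom H1" "locally_bounded_above H2 x0"
  shows "Psi (boxplus K (Epi_conj K (\<lambda>x. H1 x + H2 x)) (Epi_conj K H3)) =
    Psi (boxplus K (boxplus K (Epi_conj K H1) (Epi_conj K H2)) (Epi_conj K H3))"
proof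
  have H12: "proper_ext (\<lambda>x. H1 x + H2 x)"
    using proper_add[OF H(1,2) x0(1) locally_bounded_above_dom[OF x0(2)]] .
  show "Psi (boxplus K (boxplus K (Epi_conj K H1) (Epi_conj K H2)) (Epi_conj K H3)) \<subseteq>
      Psi (boxplus K (Epi_conj K (\<lambda>x. H1 x + H2 x)) (Epi_conj K H3))"
    using boxplus_Epi_conj_subset[OF H(1,2) H12] unfolding Psi_def boxplus_def[of K _ "Epi_conj K H3"]
    by blast
  show "Psi (boxplus K (Epi_conj K (\<lambda>x. H1 x + H2 x)) (Epi_conj K H3)) \<subseteq>
      Psi (boxplus K (boxplus K (Epi_conj K H1) (Epi_conj K H2)) (Epi_conj K H3))"
  proof
    fix p assume "p \<in> Psi (boxplus K (Epi_conj K (\<lambda>x. H1 x + H2 x)) (Epi_conj K H3))"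
    then obtain L U L3 U3 y where p: "p = (\<lambda>x. L x + L3 x, y)" and y: "Fin y \<in> ws_sum K U U3"
      and LU: "(L, U) \<in> Epi_conj K (\<lambda>x. H1 x + H2 x)" "(L3, U3) \<in> Epi_conj K H3"
      unfolding Psi_def boxplus_def by blast
    have L: "L \<in> clin" and L3: "L3 \<in> clin"
      using LU unfolding Epi_conj_iff[OF H12] Epi_conj_iff[OF H(3)] by auto
    define A where "A = (\<lambda>(x, h). L3 x - h) ` epigraph H3"
    have convA: "convex A"
      unfolding A_def using L3
      by (intro convex_linear_image conv(3))
        (auto simp: clin_def linear_add linear_scale scaleR_right_diff_distrib intro!: linearI)
    obtain z h where "H3 z = Fin h" using H(3) proper_dom_Fin[OF H(3)] unfolding proper_ext_def by blast
    then have neA: "A \<noteq> {}" unfolding A_def using graph_in_epigraph[of H3] by blast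
    have sep: "(L x - h) + a - y \<notin> interior K" if h: "H1 x + H2 x = Fin h" and a: "a \<in> A" for x h a
    proof
      assume int: "(L x - h) + a - y \<in> interior K"
      obtain z g k where a: "H3 z = Fin k" "g - k \<in> K" "a = L3 z - g"
        using a by (auto simp: A_def epigraph_def)
      have "(L x - h) + (L3 z - k) - y = ((L x - h) + a - y) + (g - k)" using a(3) by simp
      then have "(L x - h) + (L3 z - k) - y \<in> interior K" using interior_cone_add[OF int a(2)] by argo
      then show False using ws_sum_Epi_conj_not_below[OF H12 H(3) LU y h a(1)] by blast
    qed
    obtain f L1 L2 a1 a2 a3 where f: "positive_functional f" "L = (\<lambda>x. L1 x + L2 x)"
      "(L1, hyperplane f a1) \<in> Epi_conj K H1" "(L2, hyperplane f a2) \<in> Epi_conj K H2"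
      and a3: "\<And>a. a \<in> A \<Longrightarrow> f a \<le> a3" and sum: "a1 + a2 + a3 = f y"
      using conjugate_sum_splitting[OF H(1,2) conv(1,2) convA neA x0 L sep] by blast
    have "(L3, hyperplane f a3) \<in> Epi_conj K H3"
      using a3 graph_in_epigraph[of H3]
      by (intro hyperplane_in_Epi_conj H(3) f(1) L3) (force simp: A_def)
    moreover have "(L, hyperplane f (a1 + a2)) \<in> boxplus K (Epi_conj K H1) (Epi_conj K H2)"
      unfolding f(2) by (rule boxplus_hyperplaneI[OF f(1,3,4)])
    ultimately have "(\<lambda>x. L x + L3 x, hyperplane f (a1 + a2 + a3)) \<in>
        boxplus K (boxplus K (Epi_conj K H1) (Epi_conj K H2)) (Epi_conj K H3)"
      by (intro boxplus_hyperplaneI f(1))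
    moreover have "Fin y \<in> hyperplane f (a1 + a2 + a3)" using sum by (simp add: hyperplane_def)
    ultimately show "p \<in> Psi (boxplus K (boxplus K (Epi_conj K H1) (Epi_conj K H2)) (Epi_conj K H3))"
      unfolding p Psi_def by blast
  qed
qed

end

lemma boxplus_commute: "boxplus K M N = boxplus K N M"
proof -
  have "boxplus K M N \<subseteq> boxplus K N M" for M N
  proof
    fix p assume "p \<in> boxplus K M N"
    then obtain L1 U1 L2 U2 where p: "p = (\<lambda>x. L1 x + L2 x, ws_sum K U1 U2)"
      "(L1, U1) \<in> M" "(L2, U2) \<in> N" "ws_sum K U1 U2 \<in> Pp K" unfolding boxplus_def by blast
    have "p = (\<lambda>x. L2 x + L1 x, ws_sum K U2 U1)" "ws_sum K U2 U1 \<in> Pp K"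
      using p(1,4) by (simp_all add: ws_sum_def add.commute)
    then show "p \<in> boxplus K N M" using p(2,3) unfolding boxplus_def by blast
  qed
  then show ?thesis by blast
qed

theorem lemma3p4:
  fixes K :: "'y::lctvs set"
    and F1 F2 F3 :: "'x::lctvs \<Rightarrow> 'y extended"
  assumes K: "ordering_cone K"
    and F1: "proper_ext F1" "cone_convex K F1"
    and F2: "proper_ext F2" "cone_convex K F2"
    and F3: "proper_ext F3" "cone_convex K F3"
    and C0: "\<exists>x\<in>edom F1. ext_continuous_at F2 x"
  shows "epi_conj K (\<lambda>x. F1 x + F2 x) = Psi (boxplus K (Epi_conj K F1) (Epi_conj K F2)) \<and>
    Psi (boxplus K (Epi_conj K (\<lambda>x. F1 x + F2 x)) (Epi_conj K F3)) =
      Psi (boxplus K (boxplus K (Epi_conj K F1) (Epi_conj K F2)) (Epi_conj K F3)) \<and>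
    ((\<exists>x\<in>edom F1 \<inter> edom F2. ext_continuous_at F3 x) \<or>
     (\<exists>x\<in>edom F3. ext_continuous_at F1 x \<and> ext_continuous_at F2 x) \<longrightarrow>
       epi_conj K (\<lambda>x. F1 x + F2 x + F3 x) =
         Psi (boxplus K (Epi_conj K (\<lambda>x. F1 x + F2 x)) (Epi_conj K F3)) \<and>
       Psi (boxplus K (Epi_conj K (\<lambda>x. F1 x + F2 x)) (Epi_conj K F3)) =
         Psi (boxplus K (boxplus K (Epi_conj K F1) (Epi_conj K F2)) (Epi_conj K F3)))"
proof -
  interpret ordered_lctvs K by standard (rule K)
  note conv = F1(2)[folded convex_epigraph[OF F1(1)]] F2(2)[folded convex_epigraph[OF F2(1)]]
    F3(2)[folded convex_epigraph[OF F3(1)]]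
  obtain x0 where x0: "x0 \<in> edom F1" "locally_bounded_above F2 x0"
    using C0 continuous_locally_bounded_above by blast
  have F12: "proper_ext (\<lambda>x. F1 x + F2 x)"
    using proper_add[OF F1(1) F2(1) x0(1) locally_bounded_above_dom[OF x0(2)]] .
  note conv12 = convex_epigraph_add[OF conv(1,2)]
  have i: "epi_conj K (\<lambda>x. F1 x + F2 x) = Psi (boxplus K (Epi_conj K F1) (Epi_conj K F2))"
    by (rule epi_conj_add[OF F1(1) F2(1) conv(1,2) x0])
  have ii: "Psi (boxplus K (Epi_conj K (\<lambda>x. F1 x + F2 x)) (Epi_conj K F3)) =
      Psi (boxplus K (boxplus K (Epi_conj K F1) (Epi_conj K F2)) (Epi_conj K F3))"
    by (rule Psi_boxplus_add[OF F1(1) F2(1) F3(1) conv x0])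
  have iii: "epi_conj K (\<lambda>x. F1 x + F2 x + F3 x) =
      Psi (boxplus K (Epi_conj K (\<lambda>x. F1 x + F2 x)) (Epi_conj K F3))"
    if "(\<exists>x\<in>edom F1 \<inter> edom F2. ext_continuous_at F3 x) \<or>
      (\<exists>x\<in>edom F3. ext_continuous_at F1 x \<and> ext_continuous_at F2 x)"
    using that
  proof (elim disjE bexE)
    fix x assume x: "x \<in> edom F1 \<inter> edom F2" "ext_continuous_at F3 x"
    obtain h1 where h1: "F1 x = Fin h1" using proper_dom_Fin[OF F1(1)] x(1) by blast
    obtain h2 where h2: "F2 x = Fin h2" using proper_dom_Fin[OF F2(1)] x(1) by blast
    have "x \<in> edom (\<lambda>x. F1 x + F2 x)" by (simp add: edom_def h1 h2)
    from epi_conj_add[OF F12 F3(1) conv12 conv(3) this continuous_locally_bounded_above[OF x(2)]]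
    show ?thesis .
  next
    fix x assume x: "x \<in> edom F3" "ext_continuous_at F1 x \<and> ext_continuous_at F2 x"
    have "locally_bounded_above (\<lambda>x. F1 x + F2 x) x"
      using x(2) by (intro locally_bounded_above_add continuous_locally_bounded_above) auto
    \<comment> \<open>Here the sum F1 + F2 is the locally bounded mapping, so the roles in the two-term formula are exchanged.\<close>
    from epi_conj_add[OF F3(1) F12 conv(3) conv12 x(1) this]
    show ?thesis by (simp add: boxplus_commute[of K "Epi_conj K F3"] add.commute[of "F3 _"])
  qed
  show ?thesis using i ii iii by blast
qed

end
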